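(* Let $X$ be a Hilbert space, $(P,d)$ a metric space, $C\subset X$ a closed convex set, and $f\colon X\times P\to X$. Let $\bar x\in\widehat S(\bar v,\bar p)$, where $\widehat S(v,p):=\{x\in X: v\in f(x,p)+N_C(x)\}$, put $\hat v:=\bar v-f(\bar x,\bar p)$, and suppose that $f$ is differentiable with respect to $x$ at all points $(x,p)$ around $(\bar x,\bar p)$, that $\nabla_xf$ is continuous at $(\bar x,\bar p)$, and that there are a neighborhood $U_0\times P_0$ of $(\bar x,\bar p)$ and $L>0$ with $\|f(x,p_1)-f(x,p_2)\|\le Ld(p_1,p_2)$ for all $x\in U_0$, $p_1,p_2\in P_0$. Consider the statements: (i) $\bar x$ is a Lipschitzian fully stable solution to the parametric variational inequality $v\in f(x,p)+N_C(x)$ corresponding to $(\bar v,\bar p)$. (ii) $\langle\nabla_xf(\bar x,\bar p)w,w\rangle>0$ for all $w\in\mathcal H^{\rm w}(\bar x,\hat v)$, $w\ne0$. (iii) $\langle\nabla_xf(\bar x,\bar p)w,w\rangle>0$ for all $w\in\mathcal H^{\rm s}(\bar x,\hat v)$, $w\ne0$. Then: (1) If $Q(w):=\langle\nabla_xf(\bar x,\bar p)w,w\rangle$ is a Legendre form, then (ii) is sufficient for (i). (2) If $C$ is polyhedric, then (iii) is necessary for (i).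
   Context: $X$ is a real Hilbert space identified with its dual. $N_C(x)=\{v:\langle v,u-x\rangle\le0\ \forall u\in C\}$ for $x\in C$ and $N_C(x)=\emptyset$ for $x\notin C$. Lipschitzian full stability. $\bar x\in\widehat S(\bar v,\bar p)$ is a Lipschitzian fully stable solution corresponding to $(\bar v,\bar p)$ if there are a neighborhood $V\times Q\times U$ of $(\bar v,\bar p,\bar x)$, constants $\kappa,\ell>0$, and a single-valued mapping $\vartheta\colon V\times Q\to U$ defined on all of $V\times Q$ with $\mathrm{gph}\,\vartheta=\mathrm{gph}\,\widehat S\cap(V\times Q\times U)$ and $\|(v_1-v_2)-2\kappa[\vartheta(v_1,p_1)-\vartheta(v_2,p_2)]\|\le\|v_1-v_2\|+\ell\,d(p_1,p_2)$ for all $(v_1,p_1),(v_2,p_2)\in V\times Q$. Legendre form. $Q\colon X\to\mathbb R$ is a Legendre form if it is weakly lower semicontinuous, $Q(x)=\langle Ax,x\rangle$ for some linear operator $A\colon X\to X$, and whenever $x_k\to x$ weakly and $Q(x_k)\to Q(x)$, then $x_k\to x$ in norm. Cones. For $x\in C$: radial cone $\mathcal R_C(x)=\bigcup_{t>0}\frac{C-x}{t}$, tangent cone $T_C(x)=\mathrm{cl}\,\mathcal R_C(x)$; for $v\in N_C(x)$, critical cone $\mathcal K_C(x,v)=T_C(x)\cap\{v\}^\perp$. $C$ is polyhedric if $\mathcal K_C(x,v)=\mathrm{cl}\{\mathcal R_C(x)\cap\{v\}^\perp\}$ for every $x\in C$ and $v\in N_C(x)$. Outer limits. $\mathcal H^{\rm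 w}(\bar x,\hat v)$ (resp. $\mathcal H^{\rm s}(\bar x,\hat v)$) is the set of $z\in X$ for which there are sequences $(x_k,v_k)\in\mathrm{gph}\,N_C$ converging in norm to $(\bar x,\hat v)$ and $z_k\in\mathcal K_C(x_k,v_k)$ converging weakly (resp. in norm) to $z$. *)

theory Defs
  imports "HOL-Analysis.Analysis"
begin

definition weakly_tendsto :: "(nat \<Rightarrow> 'a::real_inner) \<Rightarrow> 'a \<Rightarrow> bool"
  where "weakly_tendsto xs x \<longleftrightarrow> (\<forall>u. (\<lambda>k. u \<bullet> xs k) \<longlonglongrightarrow> u \<bullet> x)"

text \<open>Weak lower semicontinuity is understood sequentially.\<close>

definition weakly_lsc :: "('a::real_inner \<Rightarrow> real) \<Rightarrow> bool"
  where "weakly_lsc Q \<longleftrightarrow>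
    (\<forall>xs x. weakly_tendsto xs x \<longrightarrow> ereal (Q x) \<le> liminf (\<lambda>k. ereal (Q (xs k))))"

definition legendre_form :: "('a::real_inner \<Rightarrow> real) \<Rightarrow> bool"
  where "legendre_form Q \<longleftrightarrow>
    weakly_lsc Q \<and>
    (\<exists>A. linear A \<and> (\<forall>x. Q x = A x \<bullet> x)) \<and>
    (\<forall>xs x. weakly_tendsto xs x \<and> (\<lambda>k. Q (xs k)) \<longlonglongrightarrow> Q x \<longrightarrow> xs \<longlonglongrightarrow> x)"

definition normal_cone :: "'a::real_inner set \<Rightarrow> 'a \<Rightarrow> 'a set"
  where "normal_cone C x = (if x \<in> C then {v. \<forall>u\<in>C. v \<bullet> (u - x) \<le> 0} else {})"

definition radial_cone :: "'a::real_vector set \<Rightarrow> 'a \<Rightarrow> 'a set"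
  where "radial_cone C x = (\<Union>t\<in>{0<..}. (\<lambda>u. (u - x) /\<^sub>R t) ` C)"

definition tangent_cone :: "'a::real_normed_vector set \<Rightarrow> 'a \<Rightarrow> 'a set"
  where "tangent_cone C x = closure (radial_cone C x)"

text \<open>Meaningful only for \<open>x \<in> C\<close> and \<open>v \<in> normal_cone C x\<close>; every use below
  carries this side condition.\<close>

definition critical_cone :: "'a::real_inner set \<Rightarrow> 'a \<Rightarrow> 'a \<Rightarrow> 'a set"
  where "critical_cone C x v = tangent_cone C x \<inter> {v}\<^sup>\<bottom>"

definition polyhedric :: "'a::real_inner set \<Rightarrow> bool"
  where "polyhedric C \<longleftrightarrow>
    (\<forall>x\<in>C. \<forall>v\<in>normal_cone C x.
       critical_cone C x v = closure (radial_cone C x \<inter> {v}\<^sup>\<bottom>))"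

definition weak_outer_critical :: "'a::real_inner set \<Rightarrow> 'a \<Rightarrow> 'a \<Rightarrow> 'a set"
  where "weak_outer_critical C x v =
    {z. \<exists>xs vs zs. (\<forall>k. vs k \<in> normal_cone C (xs k)) \<and> xs \<longlonglongrightarrow> x \<and> vs \<longlonglongrightarrow> v \<and>
          (\<forall>k. zs k \<in> critical_cone C (xs k) (vs k)) \<and> weakly_tendsto zs z}"

definition strong_outer_critical :: "'a::real_inner set \<Rightarrow> 'a \<Rightarrow> 'a \<Rightarrow> 'a set"
  where "strong_outer_critical C x v =
    {z. \<exists>xs vs zs. (\<forall>k. vs k \<in> normal_cone C (xs k)) \<and> xs \<longlonglongrightarrow> x \<and> vs \<longlonglongrightarrow> v \<and>
          (\<forall>k. zs k \<in> critical_cone C (xs k) (vs k)) \<and> zs \<longlonglongrightarrow> z}"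

definition pvi_solutions ::
    "('a::real_inner \<times> 'p \<Rightarrow> 'a) \<Rightarrow> 'a set \<Rightarrow> 'a \<Rightarrow> 'p \<Rightarrow> 'a set"
  where "pvi_solutions f C v p = {x. v \<in> (\<lambda>n. f (x, p) + n) ` normal_cone C x}"

text \<open>Neighborhoods are arbitrary sets containing the point in their interior.\<close>

definition lipschitz_fully_stable ::
    "('a::real_inner \<Rightarrow> 'p::metric_space \<Rightarrow> 'a set) \<Rightarrow> 'a \<Rightarrow> 'p \<Rightarrow> 'a \<Rightarrow> bool"
  where "lipschitz_fully_stable S vbar pbar xbar \<longleftrightarrow>
    xbar \<in> S vbar pbar \<and>
    (\<exists>V Q U \<kappa> l \<theta>.
       vbar \<in> interior V \<and> pbar \<in> interior Q \<and> xbar \<in> interior U \<and>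
       (\<kappa>::real) > 0 \<and> (l::real) > 0 \<and>
       (\<forall>v\<in>V. \<forall>p\<in>Q. \<theta> v p \<in> U) \<and>
       {(v, p, x). v \<in> V \<and> p \<in> Q \<and> x = \<theta> v p} =
         {(v, p, x). x \<in> S v p} \<inter> V \<times> Q \<times> U \<and>
       (\<forall>v1\<in>V. \<forall>v2\<in>V. \<forall>p1\<in>Q. \<forall>p2\<in>Q.
          norm ((v1 - v2) - (2 * \<kappa>) *\<^sub>R (\<theta> v1 p1 - \<theta> v2 p2))
            \<le> norm (v1 - v2) + l * dist p1 p2))"

end

theory Submission
  imports Defs "HOL-Library.Diagonal_Subsequence"
begin

text \<open>Write \<open>A\<close> for the partial derivative of \<open>f\<close> in \<open>x\<close> at the reference point and
  \<open>Q w = A w \<bullet> w\<close>. Both implications rest on one fact: since \<open>f\<close> is Lipschitz in \<open>p\<close>,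
  Lipschitzian full stability amounts to local strong monotonicity of \<open>f (\<cdot>, p) + N\<^sub>C\<close>,
  uniformly in \<open>p\<close>, together with local solvability.

  For sufficiency, weak compactness and the Legendre property turn pointwise positivity on the
  weak outer limit into a uniform bound \<open>c \<parallel>w\<parallel>\<^sup>2 \<le> Q w\<close> on all critical cones near the
  reference point (\<open>legendre_form_uniform_positivity\<close>). This infinitesimal bound must become a
  monotonicity estimate between distinct points. For that purpose \<open>A\<close> is shifted by
  \<open>lam = \<parallel>A\<parallel> + 1\<close>: the operator \<open>A + lam I + N\<^sub>C\<close> is invertible with a globally Lipschitz
  inverse \<open>T\<close>. Along a straight segment \<open>u(t)\<close> of right-hand sides, weak limits of the difference
  quotients of \<open>T (u(t))\<close> are critical directions, so the bound applies to them with modulus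
  \<open>c + lam\<close>. Since the velocity of \<open>u\<close> is constant, this can be integrated by a scalar
  argument (\<open>strong_monotone_along_curve\<close>), and \<open>T\<close> is locally Lipschitz with constant
  \<open>1 / (c + lam)\<close> (\<open>resolvent_locally_strongly_monotone\<close>). The original inequality is the fixed
  point problem \<open>x = T (v + A x + lam x - f (x, p))\<close>, where the argument of \<open>T\<close> has
  Lipschitz constant \<open>lam + c / 2\<close> in \<open>x\<close>; the excess \<open>c\<close> makes it a contraction,
  and its fixed point is the fully stable localization (\<open>lipschitz_fully_stable_if_weak_outer_critical_positive\<close>).

  For necessity, strong monotonicity is tested on pairs \<open>(x, n)\<close> and \<open>(x + t y, n)\<close> of the graph
  of the normal cone, which exist for radial directions \<open>y\<close> orthogonal to \<open>n\<close>; polyhedricity makes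
  these directions dense in the critical cone
  (\<open>strong_outer_critical_positive_if_fully_stable\<close>).\<close>

section \<open>Projections and weak compactness in Hilbert space\<close>

text \<open>The existence of the metric projection, phrased through its variational characterization:
  \<open>p\<close> is the nearest point to \<open>u\<close> exactly when \<open>u - p\<close> is normal to \<open>C\<close> at \<open>p\<close>.
  Balls need not be compact here, so the nearest point comes from a minimizing sequence.\<close>
lemma hilbert_projection:
  fixes C :: "'a::{real_inner, banach} set"
  assumes "closed C" "convex C" "C \<noteq> {}"
  shows "\<exists>p. u - p \<in> normal_cone C p"
proof -
  define d where "d = infdist u C"
  have d_le: "d \<le> norm (u - z)" if "z \<in> C" for z
    using that by (simp add: d_def infdist_le flip: dist_norm)
  have d0: "d \<ge> 0" by (simp add: d_def infdist_nonneg)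
  have "\<exists>z\<in>C. norm (u - z) < d + 1 / Suc k" for k
  proof (rule ccontr)
    assume "\<not> ?thesis"
    then have "d + 1 / Suc k \<le> infdist u C"
      unfolding infdist_notempty[OF assms(3)]
      by (intro cINF_greatest[OF assms(3)]) (force simp: dist_norm)
    then show False by (simp add: d_def)
  qed
  then obtain z where z: "\<And>k. z k \<in> C" "\<And>k. norm (u - z k) < d + 1 / Suc k" by metis
  have lim_inv: "(\<lambda>k. 1 / real (Suc k)) \<longlonglongrightarrow> 0"
    using LIMSEQ_inverse_real_of_nat by (simp add: inverse_eq_divide)
  define s where "s k = (d + 1 / Suc k)\<^sup>2 - d\<^sup>2" for k :: nat
  have lim_sq: "s \<longlonglongrightarrow> (d + 0)\<^sup>2 - d\<^sup>2"
    unfolding s_def by (intro tendsto_intros lim_inv)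
  \<comment> \<open>The parallelogram law turns minimality into the Cauchy property.\<close>
  have par: "norm (z m - z n)^2 \<le> 2 * s m + 2 * s n" for m n
  proof -
    have "(1/2) *\<^sub>R z m + (1/2) *\<^sub>R z n \<in> C"
      using convexD[OF assms(2) z(1) z(1), of "1/2" "1/2"] by simp
    from d_le[OF this] have "d\<^sup>2 \<le> norm (u - ((1/2) *\<^sub>R z m + (1/2) *\<^sub>R z n))^2"
      using d0 by (intro power_mono) auto
    moreover have "4 * norm (u - ((1/2) *\<^sub>R z m + (1/2) *\<^sub>R z n))^2 + norm (z m - z n)^2
       = 2 * norm (u - z m)^2 + 2 * norm (u - z n)^2"
      unfolding power2_norm_eq_inner
      by (simp add: algebra_simps inner_commute inner_simps)
    moreover have "norm (u - z k)^2 \<le> d\<^sup>2 + s k" for k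
      using power_mono[of "norm (u - z k)" "d + 1 / Suc k" 2] z(2)[of k] by (simp add: s_def)
    from this[of m] this[of n] calculation show ?thesis by linarith
  qed
  have "Cauchy z"
  proof (rule CauchyI)
    fix e :: real assume "e > 0"
    then have "\<forall>\<^sub>F k in sequentially. s k < e\<^sup>2 / 4"
      using order_tendstoD(2)[OF lim_sq, of "e\<^sup>2 / 4"] by simp
    then obtain N where N: "\<And>k. k \<ge> N \<Longrightarrow> s k < e\<^sup>2 / 4"
      by (auto simp: eventually_sequentially)
    have "norm (z m - z n) < e" if "m \<ge> N" "n \<ge> N" for m n
    proof -
      have "norm (z m - z n)^2 < e^2" using par[of m n] N[OF that(1)] N[OF that(2)] by linarith
      then show ?thesis using \<open>e > 0\<close> by (simp add: power_less_imp_less_base)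
    qed
    then show "\<exists>M. \<forall>m\<ge>M. \<forall>n\<ge>M. norm (z m - z n) < e" by blast
  qed
  then obtain p where p: "z \<longlonglongrightarrow> p" using Cauchy_convergent_iff convergent_def by blast
  have pC: "p \<in> C" using closed_sequentially[OF assms(1) z(1) p] .
  have "(\<lambda>k. d + 1 / Suc k) \<longlonglongrightarrow> d + 0" by (intro tendsto_intros lim_inv)
  then have "norm (u - p) \<le> d + 0"
    by (rule LIMSEQ_le[OF tendsto_norm[OF tendsto_diff[OF tendsto_const p]]])
       (use z(2) less_imp_le in blast)
  then have pd: "norm (u - p) \<le> d" by simp
  have "(u - p) \<bullet> (y - p) \<le> 0" if y: "y \<in> C" for y
  proof (rule ccontr)
    define a where "a = (u - p) \<bullet> (y - p)"
    assume "\<not> ?thesis"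
    then have a: "a > 0" by (simp add: a_def)
    define b where "b = (norm (y - p))^2"
    define t where "t = min 1 (a / (b + 1))"
    have b: "b \<ge> 0" by (simp add: b_def)
    have t: "0 < t" "t \<le> 1" using a b by (auto simp: t_def)
    have "t \<le> a / (b + 1)" by (simp add: t_def)
    then have "t * (b + 1) \<le> a" using b by (simp add: pos_le_divide_eq)
    then have tb: "t * b < 2 * a" using t a b by (simp add: algebra_simps)
    have "(1 - t) *\<^sub>R p + t *\<^sub>R y \<in> C" using convexD[OF assms(2) pC y, of "1-t" t] t by simp
    from d_le[OF this] have "norm (u - p)^2 \<le> norm (u - ((1 - t) *\<^sub>R p + t *\<^sub>R y))^2"
      using pd by (intro power_mono) auto
    also have "\<dots> = norm (u - p)^2 - 2 * t * a + t * t * b"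
      unfolding power2_norm_eq_inner a_def b_def
      by (simp add: algebra_simps inner_commute inner_simps)
    finally have "t * (2 * a) \<le> t * (t * b)" by simp
    then show False using t tb by simp
  qed
  then show ?thesis using pC by (auto simp: normal_cone_def)
qed

lemma normal_coneD:
  assumes "v \<in> normal_cone C x"
  shows "x \<in> C" "\<And>u. u \<in> C \<Longrightarrow> v \<bullet> (u - x) \<le> 0"
  using assms by (auto simp: normal_cone_def split: if_splits)

lemma normal_cone_monotone:
  assumes "v \<in> normal_cone C x" "v' \<in> normal_cone C x'"
  shows "(v - v') \<bullet> (x - x') \<ge> 0"
  using normal_coneD(2)[OF assms(1) normal_coneD(1)[OF assms(2)]]
    normal_coneD(2)[OF assms(2) normal_coneD(1)[OF assms(1)]]
  by (simp add: algebra_simps inner_simps)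

lemma normal_cone_scale:
  assumes "v \<in> normal_cone C x" "t \<ge> 0"
  shows "t *\<^sub>R v \<in> normal_cone C x"
  using assms by (auto simp: normal_cone_def mult_nonneg_nonpos split: if_splits)

lemma projection_subspace_orthogonal:
  fixes M :: "'a::real_inner set"
  assumes "subspace M" "u - p \<in> normal_cone M p" "z \<in> M"
  shows "(u - p) \<bullet> z = 0"
proof -
  note p = normal_coneD[OF assms(2)]
  have "p + z \<in> M" "p - z \<in> M"
    using assms p(1) by (auto simp: subspace_add subspace_diff)
  then show ?thesis using p(2)[of "p + z"] p(2)[of "p - z"] by simp
qed

text \<open>A representing vector is found on the line orthogonal to the kernel, which the
  projection onto the kernel supplies.\<close>
lemma riesz_representation:
  fixes \<phi> :: "'a::{real_inner, banach} \<Rightarrow> real"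
  assumes "bounded_linear \<phi>"
  shows "\<exists>x. \<forall>u. \<phi> u = u \<bullet> x"
proof (cases "\<forall>u. \<phi> u = 0")
  case True
  then show ?thesis by (intro exI[of _ 0]) simp
next
  case False
  then obtain y where y: "\<phi> y \<noteq> 0" by blast
  interpret bounded_linear \<phi> by fact
  let ?M = "{u. \<phi> u = 0}"
  have "closed ?M"
    by (intro closed_Collect_eq continuous_intros linear_continuous_on[OF assms])
  moreover have M: "subspace ?M"
    by (auto simp: subspace_def add scaleR zero)
  ultimately obtain p where p: "y - p \<in> normal_cone ?M p"
    using hilbert_projection[of ?M y] subspace_imp_convex[OF M] subspace_0[OF M] by blast
  define e where "e = y - p"
  have "\<phi> p = 0" using normal_coneD(1)[OF p] by simp
  then have e: "\<phi> e = \<phi> y" by (simp add: e_def diff)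
  then have "e \<noteq> 0" using y zero by auto
  have "\<phi> u = u \<bullet> ((\<phi> e / (e \<bullet> e)) *\<^sub>R e)" for u
  proof -
    have "\<phi> (\<phi> e *\<^sub>R u - \<phi> u *\<^sub>R e) = 0" by (simp add: diff scaleR)
    then have "e \<bullet> (\<phi> e *\<^sub>R u - \<phi> u *\<^sub>R e) = 0"
      using projection_subspace_orthogonal[OF M p] by (simp add: e_def)
    then show ?thesis using \<open>e \<noteq> 0\<close> by (simp add: inner_simps inner_commute field_simps)
  qed
  then show ?thesis by blast
qed

text \<open>A diagonal argument gives a subsequence whose inner products with every member of the
  original sequence converge. The set of all \<open>u\<close> for which the inner products converge is a
  closed subspace containing the sequence, and its orthogonal complement lies in it trivially,
  so it is the whole space. The limits then form a bounded functional, and Riesz represents it.\<close>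
lemma bounded_weakly_convergent_subsequence:
  fixes xs :: "nat \<Rightarrow> 'a::{real_inner, banach}"
  assumes bnd: "\<And>k. norm (xs k) \<le> B"
  shows "\<exists>r x. strict_mono (r :: nat \<Rightarrow> nat) \<and> weakly_tendsto (xs \<circ> r) x"
proof -
  have B: "B \<ge> 0" using bnd[of 0] norm_ge_zero order_trans by blast
  let ?P = "\<lambda>i (s::nat \<Rightarrow> nat). convergent (\<lambda>k. xs i \<bullet> xs (s k))"
  interpret subseqs ?P
  proof
    fix i and s :: "nat \<Rightarrow> nat" assume "strict_mono s"
    have "\<forall>k. xs i \<bullet> xs (s k) \<in> cball 0 (B * B)"
    proof
      fix k
      have "\<bar>xs i \<bullet> xs (s k)\<bar> \<le> norm (xs i) * norm (xs (s k))" by (rule Cauchy_Schwarz_ineq2)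
      also have "\<dots> \<le> B * B" by (intro mult_mono bnd B norm_ge_zero)
      finally show "xs i \<bullet> xs (s k) \<in> cball 0 (B * B)" by simp
    qed
    then obtain l r where "strict_mono r" "((\<lambda>k. xs i \<bullet> xs (s k)) \<circ> r) \<longlonglongrightarrow> l"
      using compact_imp_seq_compact[OF compact_cball, of 0 "B*B"] unfolding seq_compact_def by metis
    then show "\<exists>r'. strict_mono r' \<and> ?P i (s \<circ> r')" by (auto simp: convergent_def o_def)
  qed
  define r where "r = diagseq"
  have r: "strict_mono r" unfolding r_def by (rule subseq_diagseq)
  have conv_i: "convergent (\<lambda>k. xs i \<bullet> xs (r k))" for i
  proof -
    have "?P i (diagseq \<circ> (+) (Suc i))"
    proof (rule diagseq_holds)
      fix n and r s :: "nat \<Rightarrow> nat"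
      assume "strict_mono r" "?P n s"
      then show "?P n (s \<circ> r)" using convergent_subseq_convergent[of "\<lambda>k. xs n \<bullet> xs (s k)" r]
        by (simp add: o_def)
    qed
    then show ?thesis
      using convergent_ignore_initial_segment[of "\<lambda>k. xs i \<bullet> xs (r k)" "Suc i"]
      by (simp add: r_def o_def add.commute)
  qed
  define S where "S = {u. convergent (\<lambda>k. u \<bullet> xs (r k))}"
  have S: "subspace S"
    unfolding subspace_def S_def
    by (auto simp: inner_simps intro!: convergent_add convergent_mult convergent_const)
  \<comment> \<open>The evaluations \<open>u \<mapsto> u \<bullet> xs j\<close> are equicontinuous, with common constant \<open>B\<close>.\<close>
  have "closed S"
    unfolding closed_sequential_limits
  proof (intro allI impI, elim conjE)
    fix us u assume us: "\<forall>n. us n \<in> S" "us \<longlonglongrightarrow> u"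
    have "Cauchy (\<lambda>k. u \<bullet> xs (r k))"
    proof (rule CauchyI)
      fix e :: real assume e: "e > 0"
      define e' where "e' = e / (4 * (B + 1))"
      have "e' > 0" using e B by (simp add: e'_def)
      then obtain n where n: "norm (us n - u) < e'" using us(2) LIMSEQ_D by blast
      have ne: "norm (us n - u) * B \<le> e / 4"
      proof -
        have "norm (us n - u) * B \<le> e' * (B + 1)" using n B \<open>e' > 0\<close> by (intro mult_mono) auto
        also have "\<dots> = e / 4" using B by (simp add: e'_def field_simps)
        finally show ?thesis .
      qed
      have close: "\<bar>us n \<bullet> xs j - u \<bullet> xs j\<bar> \<le> e / 4" for j
      proof -
        have "\<bar>us n \<bullet> xs j - u \<bullet> xs j\<bar> \<le> norm (us n - u) * norm (xs j)"
          using Cauchy_Schwarz_ineq2[of "us n - u"] by (simp add: inner_simps)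
        also have "\<dots> \<le> norm (us n - u) * B" by (intro mult_left_mono bnd) auto
        finally show ?thesis using ne by simp
      qed
      have "Cauchy (\<lambda>k. us n \<bullet> xs (r k))" using us(1) by (auto simp: S_def Cauchy_convergent_iff)
      then obtain M where M: "\<And>j k. j \<ge> M \<Longrightarrow> k \<ge> M \<Longrightarrow> \<bar>us n \<bullet> xs (r j) - us n \<bullet> xs (r k)\<bar> < e / 4"
        using CauchyD[of _ "e/4"] e by (metis real_norm_def zero_less_divide_iff zero_less_numeral)
      have "norm (u \<bullet> xs (r j) - u \<bullet> xs (r k)) < e" if "j \<ge> M" "k \<ge> M" for j k
        using M[OF that] close[of "r j"] close[of "r k"] e unfolding real_norm_def by linarith
      then show "\<exists>M. \<forall>m\<ge>M. \<forall>n\<ge>M. norm (u \<bullet> xs (r m) - u \<bullet> xs (r n)) < e" by blast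
    qed
    then show "u \<in> S" by (simp add: S_def Cauchy_convergent_iff)
  qed
  have xsS: "xs i \<in> S" for i using conv_i by (simp add: S_def)
  have all: "u \<in> S" for u
  proof -
    obtain p where p: "u - p \<in> normal_cone S p"
      using hilbert_projection[OF \<open>closed S\<close> subspace_imp_convex[OF S]] subspace_0[OF S] by blast
    have "(u - p) \<bullet> xs j = 0" for j by (rule projection_subspace_orthogonal[OF S p xsS])
    then have "u - p \<in> S" by (simp add: S_def convergent_const)
    then show ?thesis using subspace_add[OF S _ normal_coneD(1)[OF p]] by fastforce
  qed
  define \<phi> where "\<phi> u = lim (\<lambda>k. u \<bullet> xs (r k))" for u
  have lim: "(\<lambda>k. u \<bullet> xs (r k)) \<longlonglongrightarrow> \<phi> u" for u
    using all[of u] by (simp add: S_def \<phi>_def convergent_LIMSEQ_iff)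
  have "bounded_linear \<phi>"
  proof (rule bounded_linear_intro)
    fix u v :: 'a and c :: real
    show "\<phi> (u + v) = \<phi> u + \<phi> v"
      using LIMSEQ_unique[OF lim[of "u + v"]] tendsto_add[OF lim[of u] lim[of v]]
      by (simp add: inner_simps)
    show "\<phi> (c *\<^sub>R u) = c *\<^sub>R \<phi> u"
      using LIMSEQ_unique[OF lim[of "c *\<^sub>R u"]] tendsto_mult[OF tendsto_const[of c] lim[of u]]
      by (simp add: inner_simps)
    show "norm (\<phi> u) \<le> norm u * B"
    proof (rule LIMSEQ_le_const2[OF tendsto_norm[OF lim[of u]]])
      have "norm (u \<bullet> xs (r k)) \<le> norm u * B" for k
        using Cauchy_Schwarz_ineq2[of u "xs (r k)"] mult_left_mono[OF bnd[of "r k"], of "norm u"]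
        by simp
      then show "\<exists>N. \<forall>k\<ge>N. norm (u \<bullet> xs (r k)) \<le> norm u * B" by blast
    qed
  qed
  then obtain x where "\<And>u. \<phi> u = u \<bullet> x" using riesz_representation by blast
  then have "weakly_tendsto (xs \<circ> r) x" using lim by (simp add: weakly_tendsto_def)
  then show ?thesis using r by blast
qed

lemma weakly_lsc_le:
  assumes "weakly_lsc Q" "weakly_tendsto xs x" "\<And>k. Q (xs k) \<le> b k" "b \<longlonglongrightarrow> B"
  shows "Q x \<le> B"
proof -
  have "ereal (Q x) \<le> liminf (\<lambda>k. ereal (Q (xs k)))"
    using assms(1,2) by (simp add: weakly_lsc_def)
  also have "\<dots> \<le> liminf (\<lambda>k. ereal (b k))"
    by (intro Liminf_mono) (simp add: assms(3))
  also have "\<dots> = ereal B"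
    using assms(4) by (intro lim_imp_Liminf) auto
  finally show ?thesis by simp
qed

text \<open>Otherwise the projection residual of \<open>x\<close> would separate \<open>x\<close> from \<open>K\<close>.\<close>
lemma weakly_tendsto_mem_closed_convex:
  fixes K :: "'a::{real_inner, banach} set"
  assumes "closed K" "convex K" "\<And>k. xs k \<in> K" "weakly_tendsto xs x"
  shows "x \<in> K"
proof -
  obtain p where p: "x - p \<in> normal_cone K p"
    using hilbert_projection[OF assms(1,2)] assms(3) by blast
  have "(\<lambda>k. (x - p) \<bullet> xs k) \<longlonglongrightarrow> (x - p) \<bullet> x"
    using assms(4) by (simp add: weakly_tendsto_def)
  moreover have "(x - p) \<bullet> xs k \<le> (x - p) \<bullet> p" for k
    using normal_coneD(2)[OF p assms(3)[of k]] by (simp add: inner_simps)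
  ultimately have "(x - p) \<bullet> x \<le> (x - p) \<bullet> p" by (intro LIMSEQ_le_const2) auto
  then have "(x - p) \<bullet> (x - p) \<le> 0" by (simp add: inner_simps)
  then have "x = p" by (metis eq_iff_diff_eq_0 inner_eq_zero_iff inner_ge_zero order_antisym)
  then show ?thesis using normal_coneD(1)[OF p] by simp
qed

section \<open>Radial and critical cones\<close>

lemma radial_cone_iff:
  "w \<in> radial_cone C x \<longleftrightarrow> (\<exists>t>0. x + t *\<^sub>R w \<in> C)"
proof
  assume "w \<in> radial_cone C x"
  then show "\<exists>t>0. x + t *\<^sub>R w \<in> C" by (auto simp: radial_cone_def)
next
  assume "\<exists>t>0. x + t *\<^sub>R w \<in> C"
  then obtain t where "t > 0" "x + t *\<^sub>R w \<in> C" by blast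
  then show "w \<in> radial_cone C x"
    unfolding radial_cone_def by (auto intro!: bexI[of _ t] image_eqI[of _ _ "x + t *\<^sub>R w"])
qed

lemma radial_step_shrink:
  assumes "convex C" "x \<in> C" "x + t *\<^sub>R w \<in> C" "0 \<le> s" "s \<le> t"
  shows "x + s *\<^sub>R w \<in> C"
proof (cases "t = 0")
  case False
  have "(1 - s/t) *\<^sub>R x + (s/t) *\<^sub>R (x + t *\<^sub>R w) \<in> C"
    using assms False by (intro convexD[OF assms(1)]) auto
  then show ?thesis using False by (simp add: algebra_simps)
qed (use assms in auto)

lemma convex_radial_cone:
  assumes "convex C" "x \<in> C"
  shows "convex (radial_cone C x)"
proof (rule convexI)
  fix w1 w2 and a b :: real
  assume w: "w1 \<in> radial_cone C x" "w2 \<in> radial_cone C x" and ab: "0 \<le> a" "0 \<le> b" "a + b = 1"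
  obtain t1 t2 where t: "t1 > 0" "x + t1 *\<^sub>R w1 \<in> C" "t2 > 0" "x + t2 *\<^sub>R w2 \<in> C"
    using w by (auto simp: radial_cone_iff)
  define t where "t = min t1 t2"
  have "x + t *\<^sub>R w1 \<in> C" "x + t *\<^sub>R w2 \<in> C"
    using t by (auto simp: t_def intro: radial_step_shrink[OF assms])
  from convexD[OF assms(1) this ab]
  have "(a + b) *\<^sub>R x + t *\<^sub>R (a *\<^sub>R w1 + b *\<^sub>R w2) \<in> C" by (simp add: algebra_simps)
  then show "a *\<^sub>R w1 + b *\<^sub>R w2 \<in> radial_cone C x"
    using t ab(3) unfolding radial_cone_iff by (intro exI[of _ t]) (auto simp: t_def)
qed

text \<open>A closed convex cone is weakly closed, so weak limits of radial directions remain tangent.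
  The critical cone is thereby reached from merely bounded difference quotients of a curve in \<open>C\<close>.\<close>
lemma critical_coneI_weak_limit:
  fixes C :: "'a::{real_inner, banach} set"
  assumes "convex C" "x \<in> C" "\<And>k. q k \<in> radial_cone C x" "weakly_tendsto q w"
    and "(\<lambda>k. v \<bullet> q k) \<longlonglongrightarrow> 0"
  shows "w \<in> critical_cone C x v"
proof -
  have "w \<in> tangent_cone C x"
    unfolding tangent_cone_def
    by (rule weakly_tendsto_mem_closed_convex[of _ q])
       (use assms closure_subset in \<open>auto intro!: convex_closure convex_radial_cone\<close>)
  moreover have "v \<bullet> w = 0"
    using assms(4,5) LIMSEQ_unique by (auto simp: weakly_tendsto_def)
  ultimately show ?thesis
    by (auto simp: critical_cone_def orthogonal_comp_def orthogonal_def)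
qed

lemma critical_cone_scale:
  assumes "w \<in> critical_cone C x v" "t > 0"
  shows "t *\<^sub>R w \<in> critical_cone C x v"
proof -
  have sub: "(\<lambda>w. t *\<^sub>R w) ` radial_cone C x \<subseteq> radial_cone C x"
  proof safe
    fix w assume "w \<in> radial_cone C x"
    then obtain s where "s > 0" "x + s *\<^sub>R w \<in> C" by (auto simp: radial_cone_iff)
    then show "t *\<^sub>R w \<in> radial_cone C x"
      unfolding radial_cone_iff using assms(2) by (intro exI[of _ "s / t"]) auto
  qed
  have "t *\<^sub>R w \<in> tangent_cone C x"
  proof -
    have "w \<in> closure (radial_cone C x)" using assms(1) by (simp add: critical_cone_def tangent_cone_def)
    then have "t *\<^sub>R w \<in> closure ((\<lambda>w. t *\<^sub>R w) ` radial_cone C x)"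
      using closure_scaleR[of t "radial_cone C x"] by blast
    then show ?thesis using closure_mono[OF sub] by (auto simp: tangent_cone_def)
  qed
  then show ?thesis using assms(1)
    by (auto simp: critical_cone_def orthogonal_comp_def orthogonal_def)
qed

section \<open>Uniform positivity near the reference point\<close>

text \<open>This is where the Legendre property acts. If the bound failed, there would be critical unit
  vectors \<open>w\<^sub>k\<close> at points approaching \<open>(x, v)\<close> with \<open>Q w\<^sub>k \<le> 1/k\<close>. A weak limit belongs to the
  weak outer limit and has \<open>Q \<le> 0\<close> by lower semicontinuity, hence it vanishes; then \<open>Q w\<^sub>k\<close>
  tends to \<open>Q 0\<close>, and the Legendre property makes unit vectors converge to zero in norm.\<close>
lemma legendre_form_uniform_positivity:
  fixes C :: "'a::{real_inner, banach} set" and Q :: "'a \<Rightarrow> real"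
  assumes leg: "legendre_form Q"
    and pos: "\<And>w. w \<in> weak_outer_critical C x v \<Longrightarrow> w \<noteq> 0 \<Longrightarrow> Q w > 0"
  obtains c e where "c > 0" "e > 0"
    "\<And>y n w. n \<in> normal_cone C y \<Longrightarrow> norm (y - x) < e \<Longrightarrow> norm (n - v) < e \<Longrightarrow>
       w \<in> critical_cone C y n \<Longrightarrow> c * norm w ^ 2 \<le> Q w"
proof (rule ccontr)
  assume neg: "\<not> thesis"
  obtain A where "linear A" and QA: "\<And>w. Q w = A w \<bullet> w" using leg by (auto simp: legendre_form_def)
  have Qs: "Q (t *\<^sub>R w) = t\<^sup>2 * Q w" for t w
    using linear_scale[OF \<open>linear A\<close>] by (simp add: QA power2_eq_square)
  have "\<exists>y n w. n \<in> normal_cone C y \<and> norm (y - x) < 1 / Suc k \<and> norm (n - v) < 1 / Suc k \<and>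
      w \<in> critical_cone C y n \<and> norm w = 1 \<and> Q w \<le> 1 / Suc k" for k
  proof -
    from neg that[of "1 / Suc k" "1 / Suc k"] obtain y n w
      where *: "n \<in> normal_cone C y" "norm (y - x) < 1 / Suc k" "norm (n - v) < 1 / Suc k"
        "w \<in> critical_cone C y n" "Q w < 1 / Suc k * norm w ^ 2"
      by (metis not_le of_nat_0_less_iff zero_less_Suc zero_less_divide_1_iff)
    have w0: "w \<noteq> 0" using * Qs[of 0 w] by auto
    have "Q ((1 / norm w) *\<^sub>R w) \<le> 1 / Suc k"
      unfolding Qs using *(5) w0 by (simp add: power_divide field_simps)
    then show ?thesis using * w0 critical_cone_scale[OF *(4), of "1 / norm w"]
      by (intro exI[of _ y] exI[of _ n] exI[of _ "(1 / norm w) *\<^sub>R w"]) auto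
  qed
  then obtain ys ns ws where s: "\<And>k. ns k \<in> normal_cone C (ys k)"
      "\<And>k::nat. norm (ys k - x) < 1 / Suc k" "\<And>k. norm (ns k - v) < 1 / Suc k"
      "\<And>k. ws k \<in> critical_cone C (ys k) (ns k)" "\<And>k. norm (ws k) = 1" "\<And>k. Q (ws k) \<le> 1 / Suc k"
    by metis
  have inv0: "(\<lambda>k. 1 / real (Suc k)) \<longlonglongrightarrow> 0"
    using LIMSEQ_inverse_real_of_nat by (simp add: inverse_eq_divide)
  have squeeze: "as \<longlonglongrightarrow> a" if "\<And>k. norm (as k - a) < 1 / Suc k" for as and a :: 'a
    by (rule LIM_zero_cancel, rule Lim_null_comparison[OF always_eventually inv0])
       (use that less_imp_le in blast)
  have ys: "ys \<longlonglongrightarrow> x" and ns: "ns \<longlonglongrightarrow> v"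
    using squeeze s(2,3) by blast+
  obtain r w where r: "strict_mono (r::nat\<Rightarrow>nat)" and w: "weakly_tendsto (ws \<circ> r) w"
    using bounded_weakly_convergent_subsequence[of ws 1] s(5) by auto
  have inv0r: "(\<lambda>k. 1 / real (Suc (r k))) \<longlonglongrightarrow> 0"
    using LIMSEQ_subseq_LIMSEQ[OF inv0 r] by (simp add: o_def)
  have "w \<in> weak_outer_critical C x v"
    unfolding weak_outer_critical_def
    using w s(1,4) LIMSEQ_subseq_LIMSEQ[OF ys r] LIMSEQ_subseq_LIMSEQ[OF ns r]
    by (intro CollectI exI[of _ "ys \<circ> r"] exI[of _ "ns \<circ> r"] exI[of _ "ws \<circ> r"]) auto
  moreover have lsc: "weakly_lsc Q" using leg by (simp add: legendre_form_def)
  have "Q w \<le> 0"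
    by (rule weakly_lsc_le[OF lsc w _ inv0r]) (simp add: s(6) del: of_nat_Suc)
  ultimately have w0: "w = 0" using pos[of w] by fastforce
  have Q0: "Q 0 = 0" by (simp add: QA)
  have "(\<lambda>k. Q (ws (r k))) \<longlonglongrightarrow> 0"
  proof (rule order_tendstoI)
    fix a :: real assume "a < 0"
    have "ereal 0 \<le> liminf (\<lambda>k. ereal (Q ((ws \<circ> r) k)))"
      using lsc w w0 Q0 by (metis weakly_lsc_def)
    moreover have "ereal a < ereal 0" using \<open>a < 0\<close> by simp
    ultimately have "ereal a < liminf (\<lambda>k. ereal (Q ((ws \<circ> r) k)))" by (rule order.strict_trans2[rotated])
    from less_LiminfD[OF this] show "\<forall>\<^sub>F k in sequentially. a < Q (ws (r k))" by simp
  next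
    fix a :: real assume "0 < a"
    from order_tendstoD(2)[OF inv0r this] show "\<forall>\<^sub>F k in sequentially. Q (ws (r k)) < a"
      by (rule eventually_mono) (use s(6) in \<open>auto intro: le_less_trans\<close>)
  qed
  then have "(ws \<circ> r) \<longlonglongrightarrow> 0"
    using leg w w0 Q0 unfolding legendre_form_def by (simp add: o_def)
  then have "(\<lambda>k. norm ((ws \<circ> r) k)) \<longlonglongrightarrow> 0" by (rule tendsto_norm_zero)
  then show False using s(5) by (simp add: LIMSEQ_const_iff)
qed

section \<open>From critical directions to strong monotonicity\<close>

text \<open>A mean value principle that needs one good step to the right of each point: the last point
  of \<open>[0, 1]\<close> at which \<open>\<psi> t + e t\<close> has not dropped below \<open>\<psi> 0\<close> must be \<open>1\<close>.\<close>
lemma nonneg_increment_from_right_steps: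
  fixes \<psi> :: "real \<Rightarrow> real"
  assumes cont: "continuous_on {0..1} \<psi>"
    and step: "\<And>t e. 0 \<le> t \<Longrightarrow> t < 1 \<Longrightarrow> e > 0 \<Longrightarrow> \<exists>s. 0 < s \<and> s \<le> 1 - t \<and> \<psi> (t + s) \<ge> \<psi> t - e * s"
  shows "\<psi> 0 \<le> \<psi> 1"
proof (rule field_le_epsilon)
  fix e :: real assume e: "e > 0"
  define S where "S = {t \<in> {0..1}. \<psi> 0 \<le> \<psi> t + e * t}"
  have "compact S"
  proof -
    have "closed S" unfolding S_def
      by (intro continuous_on_closed_Collect_le continuous_intros cont)
    moreover have "{0..1} \<inter> S = S" by (auto simp: S_def)
    ultimately show ?thesis using compact_Int_closed[of "{0..1::real}" S] by simp
  qed
  moreover have "0 \<in> S" by (simp add: S_def)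
  ultimately obtain t where t: "t \<in> S" "\<And>s. s \<in> S \<Longrightarrow> s \<le> t"
    using compact_attains_sup[of S] by blast
  have "t = 1"
  proof (rule ccontr)
    assume "t \<noteq> 1"
    then have t1: "0 \<le> t" "t < 1" using t(1) by (auto simp: S_def)
    obtain s where s: "0 < s" "s \<le> 1 - t" "\<psi> (t + s) \<ge> \<psi> t - e * s" using step[OF t1 e] by blast
    then have "t + s \<in> S" using t(1) by (auto simp: S_def algebra_simps)
    then show False using t(2)[of "t + s"] s(1) by simp
  qed
  then show "\<psi> 0 \<le> \<psi> 1 + e" using t(1) by (simp add: S_def)
qed

text \<open>Let \<open>x\<close> be a Lipschitz curve in \<open>C\<close> carrying normals \<open>n\<close> such that the value of
  \<open>A + lam I + N\<^sub>C\<close> moves with constant velocity \<open>h\<close>. Every weak limit \<open>w\<close> of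
  forward difference quotients of \<open>x\<close> at \<open>t\<close> is critical at \<open>(x t, n t)\<close>, and monotonicity of the
  normal cone with weak lower semicontinuity gives \<open>(c + lam) \<parallel>w\<parallel>\<^sup>2 \<le> h \<bullet> w\<close>.
  To integrate this along the curve, the convex term is replaced by its tangent at the total
  displacement \<open>D\<close>, that is \<open>\<parallel>w\<parallel>\<^sup>2 \<ge> 2 (D \<bullet> w) - \<parallel>D\<parallel>\<^sup>2\<close>. What remains is affine in \<open>w\<close>,
  so it passes to weak limits and says that the scalar function \<open>\<psi>\<close> below has nonnegative
  forward limits; that \<open>\<psi>\<close> does not decrease over \<open>[0, 1]\<close> is the claim.\<close>
lemma strong_monotone_along_curve:
  fixes C :: "'a::{real_inner, banach} set" and A :: "'a \<Rightarrow>\<^sub>L 'a"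
  assumes C: "convex C"
    and lsc: "weakly_lsc (\<lambda>w. blinfun_apply A w \<bullet> w)"
    and c: "c \<ge> 0" "lam \<ge> 0"
    and n: "\<And>t. t \<in> {0..1} \<Longrightarrow> n t \<in> normal_cone C (x t)"
    and lip: "\<And>s t. s \<in> {0..1} \<Longrightarrow> t \<in> {0..1} \<Longrightarrow> norm (x s - x t) \<le> K * \<bar>s - t\<bar>"
    and eq: "\<And>s t. s \<in> {0..1} \<Longrightarrow> t \<in> {0..1} \<Longrightarrow>
        blinfun_apply A (x s - x t) + lam *\<^sub>R (x s - x t) + (n s - n t) = (s - t) *\<^sub>R h"
    and pos: "\<And>t w. t \<in> {0..1} \<Longrightarrow> w \<in> critical_cone C (x t) (n t) \<Longrightarrow>
        c * norm w ^ 2 \<le> blinfun_apply A w \<bullet> w"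
  shows "(c + lam) * norm (x 1 - x 0) ^ 2 \<le> h \<bullet> (x 1 - x 0)"
proof -
  define D where "D = x 1 - x 0"
  define \<psi> where "\<psi> t = h \<bullet> x t - 2 * (c + lam) * (D \<bullet> x t) + (c + lam) * norm D ^ 2 * t" for t
  have K: "K \<ge> 0" using lip[of 0 1] by (auto intro: order_trans[OF norm_ge_zero])
  have contx: "continuous_on {0..1} x"
    by (rule lipschitz_on_continuous_on[of K])
       (auto simp: lipschitz_on_def K dist_norm lip)
  have "\<psi> 0 \<le> \<psi> 1"
  proof (rule nonneg_increment_from_right_steps)
    show "continuous_on {0..1} \<psi>" unfolding \<psi>_def by (intro continuous_intros contx)
  next
    fix t e :: real assume t: "0 \<le> t" "t < 1" and e: "e > 0"
    define s where "s k = (1 - t) / Suc k" for k :: nat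
    have s: "s k > 0" "s k \<le> 1 - t" for k
      using t mult_left_le[of "1 / Suc k" "1 - t"] by (auto simp: s_def)
    have s0: "s \<longlonglongrightarrow> 0"
      using tendsto_mult[OF tendsto_const[of "1-t"] LIMSEQ_inverse_real_of_nat] by (simp add: s_def[abs_def] divide_inverse)
    have t01: "t \<in> {0..1}" and ts: "t + s k \<in> {0..1}" for k
      using t s(1)[of k] s(2)[of k] by auto
    define q where "q k = (x (t + s k) - x t) /\<^sub>R s k" for k
    have xq: "x (t + s k) - x t = s k *\<^sub>R q k" for k using s(1)[of k] by (simp add: q_def)
    have qK: "norm (q k) \<le> K" for k
      using lip[OF ts[of k] t01] s(1)[of k] by (simp add: xq mult.commute)
    have qr: "q k \<in> radial_cone C (x t)" for k
      unfolding radial_cone_iff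
    proof (intro exI[of _ "s k"] conjI)
      have "x t + s k *\<^sub>R q k = x (t + s k)" using xq[of k] by (simp add: algebra_simps)
      then show "x t + s k *\<^sub>R q k \<in> C" using normal_coneD(1)[OF n[OF ts[of k]]] by simp
    qed (rule s)
    have nd: "n (t + s k) - n t = s k *\<^sub>R (h - blinfun_apply A (q k) - lam *\<^sub>R q k)" for k
      using eq[OF ts[of k] t01] by (simp add: xq blinfun.scaleR_right algebra_simps)
    define G where "G = norm h + norm A * K + lam * K"
    have nG: "norm (h - blinfun_apply A (q k) - lam *\<^sub>R q k) \<le> G" for k
    proof -
      have "norm (h - blinfun_apply A (q k) - lam *\<^sub>R q k) \<le> norm h + norm (blinfun_apply A (q k)) + norm (lam *\<^sub>R q k)"
        by (metis add_mono_thms_linordered_semiring(3) norm_triangle_ineq4 order_trans)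
      also have "\<dots> \<le> G" unfolding G_def
        using norm_blinfun[of A "q k"] mult_left_mono[OF qK[of k], of "norm A"] mult_left_mono[OF qK[of k] c(2)] c(2)
        by simp
      finally show ?thesis .
    qed
    \<comment> \<open>The normal inequalities at both ends squeeze \<open>n t \<bullet> q k\<close> between \<open>0\<close> and a quantity of
      order \<open>s k\<close>, since \<open>n\<close> is Lipschitz too; so limits of \<open>q\<close> are orthogonal to \<open>n t\<close>.\<close>
    have nq: "norm (n t \<bullet> q k) \<le> G * K * s k" for k
    proof -
      have "n t \<bullet> (x (t + s k) - x t) \<le> 0"
        by (rule normal_coneD(2)[OF n[OF t01] normal_coneD(1)[OF n[OF ts]]])
      then have 1: "n t \<bullet> q k \<le> 0" using s(1)[of k] by (simp add: xq mult_le_0_iff)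
      have "n (t + s k) \<bullet> (x t - x (t + s k)) \<le> 0"
        by (rule normal_coneD(2)[OF n[OF ts] normal_coneD(1)[OF n[OF t01]]])
      then have "s k * (n (t + s k) \<bullet> q k) \<ge> 0"
        using xq[of k] by (metis inner_minus_right inner_scaleR_right minus_diff_eq neg_le_0_iff_le)
      then have 2: "n (t + s k) \<bullet> q k \<ge> 0" using s(1)[of k] by (simp add: zero_le_mult_iff)
      have "(n (t + s k) - n t) \<bullet> q k \<le> norm (n (t + s k) - n t) * norm (q k)" by (rule norm_cauchy_schwarz)
      also have "\<dots> \<le> (s k * G) * K"
        using s(1)[of k] nG[of k] qK[of k] K order_trans[OF norm_ge_zero nG[of k]]
        by (intro mult_mono) (auto simp: nd)
      finally show ?thesis using 1 2 by (simp add: inner_simps algebra_simps)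
    qed
    obtain r w where r: "strict_mono (r::nat\<Rightarrow>nat)" and w: "weakly_tendsto (q \<circ> r) w"
      using bounded_weakly_convergent_subsequence[of q K] qK by blast
    have sr0: "(\<lambda>k. s (r k)) \<longlonglongrightarrow> 0" using LIMSEQ_subseq_LIMSEQ[OF s0 r] by (simp add: o_def)
    have "w \<in> critical_cone C (x t) (n t)"
    proof (rule critical_coneI_weak_limit[OF C normal_coneD(1)[OF n[OF t01]] _ w])
      show "(q \<circ> r) k \<in> radial_cone C (x t)" for k using qr by simp
      have "(\<lambda>k. G * K * s (r k)) \<longlonglongrightarrow> 0" using tendsto_mult_right_zero[OF sr0] .
      then show "(\<lambda>k. n t \<bullet> (q \<circ> r) k) \<longlonglongrightarrow> 0"
        by (rule Lim_null_comparison[rotated]) (use nq in auto)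
    qed
    from pos[OF t01 this] have cw: "c * norm w ^ 2 \<le> blinfun_apply A w \<bullet> w" .
    have hq: "(\<lambda>k. u \<bullet> q (r k)) \<longlonglongrightarrow> u \<bullet> w" for u
      using w by (simp add: weakly_tendsto_def)
    have Ah: "blinfun_apply A (q k) \<bullet> q k \<le> h \<bullet> q k - lam * (2 * (w \<bullet> q k) - norm w ^ 2)" for k
    proof -
      have "0 \<le> (n (t + s k) - n t) \<bullet> (x (t + s k) - x t)"
        by (rule normal_cone_monotone[OF n[OF ts] n[OF t01]])
      then have "0 \<le> s k * s k * ((h - blinfun_apply A (q k) - lam *\<^sub>R q k) \<bullet> q k)"
        by (simp add: nd xq)
      moreover have "s k * s k > 0" using s(1)[of k] by simp
      ultimately have "0 \<le> (h - blinfun_apply A (q k) - lam *\<^sub>R q k) \<bullet> q k"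
        by (meson mult_pos_neg not_le)
      \<comment> \<open>The shift term is linearized at \<open>w\<close>, leaving the form of \<open>A\<close> bounded by a convergent
        sequence, as weak lower semicontinuity requires.\<close>
      moreover have "0 \<le> (q k - w) \<bullet> (q k - w)" by simp
      then have "2 * (w \<bullet> q k) - norm w ^ 2 \<le> q k \<bullet> q k"
        by (simp add: inner_simps inner_commute power2_norm_eq_inner)
      from mult_left_mono[OF this c(2)]
      have "lam * (2 * (w \<bullet> q k) - norm w ^ 2) \<le> lam * (q k \<bullet> q k)" .
      ultimately show ?thesis by (simp add: inner_simps)
    qed
    have "blinfun_apply A w \<bullet> w \<le> h \<bullet> w - lam * (2 * (w \<bullet> w) - norm w ^ 2)"
      by (rule weakly_lsc_le[OF lsc w, of "\<lambda>k. h \<bullet> q (r k) - lam * (2 * (w \<bullet> q (r k)) - norm w ^ 2)"])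
         (use Ah in \<open>auto intro!: tendsto_intros hq\<close>)
    then have hw: "(c + lam) * norm w ^ 2 \<le> h \<bullet> w"
      using cw by (simp add: power2_norm_eq_inner algebra_simps)
    have "0 \<le> (w - D) \<bullet> (w - D)" by simp
    then have "2 * (D \<bullet> w) - norm D ^ 2 \<le> norm w ^ 2"
      by (simp add: inner_simps inner_commute power2_norm_eq_inner)
    from mult_left_mono[OF this, of "c + lam"] hw c
    have lim_ge: "h \<bullet> w - 2 * (c + lam) * (D \<bullet> w) + (c + lam) * norm D ^ 2 \<ge> 0"
      by (simp add: algebra_simps)
    have "(\<lambda>k. h \<bullet> q (r k) - 2 * (c + lam) * (D \<bullet> q (r k)) + (c + lam) * norm D ^ 2)
        \<longlonglongrightarrow> h \<bullet> w - 2 * (c + lam) * (D \<bullet> w) + (c + lam) * norm D ^ 2"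
      by (intro tendsto_intros hq)
    from order_tendstoD(1)[OF this, of "- e"] lim_ge e
    obtain k where k: "h \<bullet> q (r k) - 2 * (c + lam) * (D \<bullet> q (r k)) + (c + lam) * norm D ^ 2 > - e"
      by (auto simp: eventually_sequentially)
    define k' where "k' = r k"
    have "\<psi> (t + s k') - \<psi> t = h \<bullet> (x (t + s k') - x t) - 2 * (c + lam) * (D \<bullet> (x (t + s k') - x t)) + (c + lam) * norm D ^ 2 * s k'"
      by (simp add: \<psi>_def inner_simps algebra_simps)
    also have "\<dots> = s k' * (h \<bullet> q k' - 2 * (c + lam) * (D \<bullet> q k') + (c + lam) * norm D ^ 2)"
      unfolding xq by (simp add: algebra_simps)
    also have "\<dots> \<ge> s k' * (- e)"
      using k s(1)[of k'] unfolding k'_def by (intro mult_left_mono) auto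
    finally show "\<exists>s. 0 < s \<and> s \<le> 1 - t \<and> \<psi> t - e * s \<le> \<psi> (t + s)"
      using s[of k'] by (intro exI[of _ "s k'"]) (auto simp: algebra_simps)
  qed
  moreover have "\<psi> 1 - \<psi> 0 = h \<bullet> D - 2 * (c + lam) * (D \<bullet> D) + (c + lam) * norm D ^ 2"
    by (simp add: \<psi>_def D_def inner_simps algebra_simps)
  ultimately show ?thesis by (simp add: D_def power2_norm_eq_inner algebra_simps)
qed

lemma pvi_solutions_iff: "x \<in> pvi_solutions f C v p \<longleftrightarrow> v - f (x, p) \<in> normal_cone C x"
  unfolding pvi_solutions_def by (auto intro!: image_eqI[of _ _ "v - f (x, p)"])

lemma norm_le_if_strongly_monotone:
  fixes z d :: "'a::real_inner"
  assumes "m * norm z ^ 2 \<le> d \<bullet> z"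
  shows "m * norm z \<le> norm d"
proof (cases "z = 0")
  case False
  have "(m * norm z) * norm z \<le> norm d * norm z"
    using assms norm_cauchy_schwarz[of d z] by (simp add: power2_eq_square)
  then show ?thesis using False by simp
qed simp

section \<open>The resolvent of a shifted linear variational inequality\<close>

text \<open>The inclusion is the fixed point equation of \<open>x \<mapsto> P ((u - A x) / lam)\<close> with \<open>P\<close> the
  projection onto \<open>C\<close>, a contraction with constant \<open>\<parallel>A\<parallel> / lam\<close>.\<close>
lemma resolvent_exists:
  fixes C :: "'a::{real_inner, banach} set" and A :: "'a \<Rightarrow>\<^sub>L 'a"
  assumes "closed C" "convex C" "C \<noteq> {}" "norm A < lam"
  shows "\<exists>x. u - blinfun_apply A x - lam *\<^sub>R x \<in> normal_cone C x"
proof -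
  have lam: "lam > 0" using assms(4) norm_ge_zero[of A] by linarith
  obtain P where P: "\<And>y. y - P y \<in> normal_cone C (P y)"
    using hilbert_projection[OF assms(1-3)] by metis
  have Plip: "norm (P y - P z) \<le> norm (y - z)" for y z
  proof -
    have "1 * norm (P y - P z) ^ 2 \<le> (y - z) \<bullet> (P y - P z)"
      using normal_cone_monotone[OF P[of y] P[of z]]
      by (simp add: power2_norm_eq_inner inner_simps algebra_simps)
    from norm_le_if_strongly_monotone[OF this] show ?thesis by simp
  qed
  define F where "F x = P ((1 / lam) *\<^sub>R (u - blinfun_apply A x))" for x
  have "\<exists>!x\<in>UNIV. F x = x"
  proof (rule Banach_fix[of _ "norm A / lam"])
    fix x y :: 'a
    have "norm (F x - F y) \<le> norm ((1 / lam) *\<^sub>R (u - blinfun_apply A x) - (1 / lam) *\<^sub>R (u - blinfun_apply A y))"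
      unfolding F_def by (rule Plip)
    also have "\<dots> = (1 / lam) * norm (blinfun_apply A (y - x))"
      using lam by (simp add: blinfun.diff_right flip: scaleR_diff_right)
    also have "\<dots> \<le> (1 / lam) * (norm A * norm (y - x))"
      using lam by (intro mult_left_mono norm_blinfun) auto
    finally show "dist (F x) (F y) \<le> norm A / lam * dist x y"
      by (simp add: dist_norm norm_minus_commute)
  qed (use assms(4) lam in \<open>auto simp: complete_UNIV\<close>)
  then obtain x where x: "F x = x" by blast
  have "(1 / lam) *\<^sub>R (u - blinfun_apply A x) - x \<in> normal_cone C x"
    using P[of "(1 / lam) *\<^sub>R (u - blinfun_apply A x)"] x by (simp add: F_def)
  from normal_cone_scale[OF this, of lam] lam
  have "u - blinfun_apply A x - lam *\<^sub>R x \<in> normal_cone C x" by (simp add: scaleR_diff_right)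
  then show ?thesis ..
qed

text \<open>The shift \<open>\<parallel>A\<parallel> + 1\<close> makes \<open>A + (\<parallel>A\<parallel> + 1) I\<close> strongly monotone with modulus 1,
  as \<open>A w \<bullet> w \<ge> - \<parallel>A\<parallel> \<parallel>w\<parallel>\<^sup>2\<close>.\<close>
lemma resolvent_nonexpansive:
  fixes A :: "'a::real_inner \<Rightarrow>\<^sub>L 'a"
  assumes "u1 - blinfun_apply A x1 - (norm A + 1) *\<^sub>R x1 \<in> normal_cone C x1"
    and "u2 - blinfun_apply A x2 - (norm A + 1) *\<^sub>R x2 \<in> normal_cone C x2"
  shows "norm (x1 - x2) \<le> norm (u1 - u2)"
proof -
  define z where "z = x1 - x2"
  have "\<bar>blinfun_apply A z \<bullet> z\<bar> \<le> norm (blinfun_apply A z) * norm z" by (rule Cauchy_Schwarz_ineq2)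
  also have "\<dots> \<le> (norm A * norm z) * norm z" by (intro mult_right_mono norm_blinfun) auto
  finally have A: "- (blinfun_apply A z \<bullet> z) \<le> norm A * norm z ^ 2" by (simp add: power2_eq_square)
  have "0 \<le> ((u1 - u2) - blinfun_apply A z - (norm A + 1) *\<^sub>R z) \<bullet> z"
    using normal_cone_monotone[OF assms] by (simp add: z_def blinfun.diff_right algebra_simps)
  then have "1 * norm z ^ 2 \<le> (u1 - u2) \<bullet> z"
    using A by (simp add: inner_simps power2_norm_eq_inner algebra_simps)
  from norm_le_if_strongly_monotone[OF this] show ?thesis by (simp add: z_def)
qed

text \<open>Along a segment in the space of right-hand sides the globally Lipschitz resolvent \<open>T\<close> traces a
  curve to which \<open>strong_monotone_along_curve\<close> applies. The modulus exceeds the shift \<open>lam\<close> by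
  \<open>c\<close>; this excess is what survives when the shift is removed.\<close>
lemma resolvent_locally_strongly_monotone:
  fixes C :: "'a::{real_inner, banach} set" and A :: "'a \<Rightarrow>\<^sub>L 'a"
  defines "lam \<equiv> norm A + 1"
  assumes C: "convex C"
    and lsc: "weakly_lsc (\<lambda>w. blinfun_apply A w \<bullet> w)"
    and T: "\<And>u. u - blinfun_apply A (T u) - lam *\<^sub>R T u \<in> normal_cone C (T u)"
    and n0: "n0 \<in> normal_cone C x0" and c: "c \<ge> 0" and e: "e > 0"
    and pos: "\<And>y n w. n \<in> normal_cone C y \<Longrightarrow> norm (y - x0) < e \<Longrightarrow> norm (n - n0) < e \<Longrightarrow>
       w \<in> critical_cone C y n \<Longrightarrow> c * norm w ^ 2 \<le> blinfun_apply A w \<bullet> w"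
  obtains \<rho> where "\<rho> > 0"
    "\<And>u1 u2. u1 \<in> ball (blinfun_apply A x0 + lam *\<^sub>R x0 + n0) \<rho> \<Longrightarrow>
       u2 \<in> ball (blinfun_apply A x0 + lam *\<^sub>R x0 + n0) \<rho> \<Longrightarrow>
       (c + lam) * norm (T u1 - T u2) ^ 2 \<le> (u1 - u2) \<bullet> (T u1 - T u2)"
proof -
  define u0 where "u0 = blinfun_apply A x0 + lam *\<^sub>R x0 + n0"
  define G where "G = 1 + norm A + lam"
  have lam: "lam \<ge> 0" by (simp add: lam_def)
  have G: "G \<ge> 1" using lam by (simp add: G_def)
  have lip: "norm (T u - T u') \<le> norm (u - u')" for u u'
    using resolvent_nonexpansive[of u A "T u" C u' "T u'"] T unfolding lam_def by blast
  have T0: "T u0 = x0"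
    using resolvent_nonexpansive[of u0 A "T u0" C u0 x0] T n0 unfolding lam_def u0_def
    by (simp add: algebra_simps)
  define n where "n u = u - blinfun_apply A (T u) - lam *\<^sub>R T u" for u
  have nn0: "norm (n u - n0) \<le> G * norm (u - u0)" for u
  proof -
    have "n u - n0 = (u - u0) - blinfun_apply A (T u - T u0) - lam *\<^sub>R (T u - T u0)"
      unfolding T0 by (simp add: n_def u0_def blinfun.diff_right algebra_simps)
    also have "norm \<dots> \<le> norm (u - u0) + norm (blinfun_apply A (T u - T u0)) + norm (lam *\<^sub>R (T u - T u0))"
      by (metis add_mono_thms_linordered_semiring(3) norm_triangle_ineq4 order_trans)
    also have "\<dots> \<le> norm (u - u0) + norm A * norm (u - u0) + lam * norm (u - u0)"
      using order_trans[OF norm_blinfun[of A "T u - T u0"] mult_left_mono[OF lip[of u u0]]]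
        mult_left_mono[OF lip[of u u0] lam] lam by (intro add_mono) auto
    finally show ?thesis by (simp add: G_def algebra_simps)
  qed
  have near: "norm (T u - x0) < e" "norm (n u - n0) < e" if "u \<in> ball u0 (e / G)" for u
  proof -
    have u: "G * norm (u - u0) < e"
      using that G by (simp add: dist_norm norm_minus_commute pos_less_divide_eq mult.commute)
    have "norm (u - u0) \<le> G * norm (u - u0)" using G by (simp add: mult_le_cancel_right1)
    then show "norm (T u - x0) < e" "norm (n u - n0) < e"
      using u nn0[of u] lip[of u u0] unfolding T0 by linarith+
  qed
  show thesis
  proof (rule that[of "e / G"], fold u0_def)
    show "e / G > 0" using e G by simp
    fix u1 u2 assume u: "u1 \<in> ball u0 (e / G)" "u2 \<in> ball u0 (e / G)"
    define \<gamma> where "\<gamma> t = u2 + t *\<^sub>R (u1 - u2)" for t :: real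
    have \<gamma>: "\<gamma> t \<in> ball u0 (e / G)" if "t \<in> {0..1}" for t
    proof -
      have "\<gamma> t = (1 - t) *\<^sub>R u2 + t *\<^sub>R u1" by (simp add: \<gamma>_def algebra_simps)
      then show ?thesis using convexD[OF convex_ball u(2,1), of "1 - t" t] that by simp
    qed
    have \<gamma>d: "\<gamma> s - \<gamma> t = (s - t) *\<^sub>R (u1 - u2)" for s t by (simp add: \<gamma>_def algebra_simps)
    have "(c + lam) * norm (T (\<gamma> 1) - T (\<gamma> 0)) ^ 2 \<le> (u1 - u2) \<bullet> (T (\<gamma> 1) - T (\<gamma> 0))"
    proof (rule strong_monotone_along_curve[OF C lsc c lam, where n = "\<lambda>t. n (\<gamma> t)" and K = "norm (u1 - u2)"])
      fix s t :: real
      show "n (\<gamma> t) \<in> normal_cone C (T (\<gamma> t))" unfolding n_def by (rule T)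
      show "norm (T (\<gamma> s) - T (\<gamma> t)) \<le> norm (u1 - u2) * \<bar>s - t\<bar>"
        using lip[of "\<gamma> s" "\<gamma> t"] by (simp add: \<gamma>d mult.commute)
      show "blinfun_apply A (T (\<gamma> s) - T (\<gamma> t)) + lam *\<^sub>R (T (\<gamma> s) - T (\<gamma> t)) + (n (\<gamma> s) - n (\<gamma> t)) = (s - t) *\<^sub>R (u1 - u2)"
        unfolding \<gamma>d[symmetric] by (simp add: n_def blinfun.diff_right algebra_simps)
    next
      fix t :: real and w assume "t \<in> {0..1}" "w \<in> critical_cone C (T (\<gamma> t)) (n (\<gamma> t))"
      then show "c * norm w ^ 2 \<le> blinfun_apply A w \<bullet> w"
        using pos[OF _ near[OF \<gamma>]] T[of "\<gamma> t"] by (auto simp: n_def)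
    qed
    then show "(c + lam) * norm (T u1 - T u2) ^ 2 \<le> (u1 - u2) \<bullet> (T u1 - T u2)" by (simp add: \<gamma>_def)
  qed
qed

section \<open>Sufficiency for full stability\<close>

lemma uniform_strict_differentiability:
  fixes f :: "'a::real_normed_vector \<times> 'p::metric_space \<Rightarrow> 'b::real_normed_vector"
    and f' :: "'a \<times> 'p \<Rightarrow> 'a \<Rightarrow>\<^sub>L 'b"
  assumes "\<forall>\<^sub>F (x, p) in nhds (x0, p0). ((\<lambda>y. f (y, p)) has_derivative blinfun_apply (f' (x, p))) (at x)"
    and "isCont f' (x0, p0)" and "e > 0"
  obtains \<delta> where "\<delta> > 0"
    "\<And>x y p. x \<in> ball x0 \<delta> \<Longrightarrow> y \<in> ball x0 \<delta> \<Longrightarrow> p \<in> ball p0 \<delta> \<Longrightarrow>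
      norm (f (x, p) - f (y, p) - blinfun_apply (f' (x0, p0)) (x - y)) \<le> e * norm (x - y)"
proof -
  have "\<forall>\<^sub>F z in nhds (x0, p0). dist (f' z) (f' (x0, p0)) < e"
    using assms(2,3) by (auto simp: isCont_def eventually_at_filter dest!: tendstoD elim!: eventually_mono)
  with assms(1) have "\<forall>\<^sub>F z in nhds (x0, p0).
      ((\<lambda>y. f (y, snd z)) has_derivative blinfun_apply (f' z)) (at (fst z)) \<and> dist (f' z) (f' (x0, p0)) < e"
    by eventually_elim auto
  then obtain d where d: "d > 0" "\<And>z. dist z (x0, p0) < d \<Longrightarrow>
      ((\<lambda>y. f (y, snd z)) has_derivative blinfun_apply (f' z)) (at (fst z)) \<and> dist (f' z) (f' (x0, p0)) < e"
    unfolding eventually_nhds_metric by blast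
  show thesis
  proof (rule that[of "d / 2"])
    show "d / 2 > 0" using d by simp
    fix x y p assume xy: "x \<in> ball x0 (d/2)" "y \<in> ball x0 (d/2)" and p: "p \<in> ball p0 (d/2)"
    let ?A = "f' (x0, p0)"
    have z: "((\<lambda>y. f (y, p)) has_derivative blinfun_apply (f' (z, p))) (at z)" "dist (f' (z, p)) ?A < e"
      if "z \<in> ball x0 (d/2)" for z
    proof -
      have "dist (z, p) (x0, p0) \<le> dist z x0 + dist p p0"
        by (simp add: dist_Pair_Pair sqrt_sum_squares_le_sum)
      also have "\<dots> < d" using that p by (simp add: dist_commute)
      finally show "((\<lambda>y. f (y, p)) has_derivative blinfun_apply (f' (z, p))) (at z)" "dist (f' (z, p)) ?A < e"
        using d(2)[of "(z, p)"] by auto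
    qed
    have "norm ((f (x, p) - blinfun_apply ?A x) - (f (y, p) - blinfun_apply ?A y)) \<le> e * norm (x - y)"
    proof (rule differentiable_bound[where S = "ball x0 (d/2)" and f = "\<lambda>z. f (z, p) - blinfun_apply ?A z"
          and f' = "\<lambda>z. blinfun_apply (f' (z, p) - ?A)"])
      fix z assume zb: "z \<in> ball x0 (d/2)"
      have "((\<lambda>z. f (z, p) - blinfun_apply ?A z) has_derivative (\<lambda>w. blinfun_apply (f' (z, p)) w - blinfun_apply ?A w)) (at z within ball x0 (d/2))"
        by (intro has_derivative_diff has_derivative_at_withinI[OF z(1)[OF zb]]
            bounded_linear_imp_has_derivative blinfun.bounded_linear_right)
      then show "((\<lambda>z. f (z, p) - blinfun_apply ?A z) has_derivative blinfun_apply (f' (z, p) - ?A)) (at z within ball x0 (d/2))"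
        by (simp add: blinfun.diff_left[abs_def] fun_diff_def)
      show "onorm (blinfun_apply (f' (z, p) - ?A)) \<le> e"
        using z(2)[OF zb] by (simp add: dist_norm norm_blinfun.rep_eq)
    qed (use xy in auto)
    then show "norm (f (x, p) - f (y, p) - blinfun_apply ?A (x - y)) \<le> e * norm (x - y)"
      by (simp add: blinfun.diff_right algebra_simps)
  qed
qed

text \<open>With \<open>T\<close> the resolvent of \<open>A + lam I + N\<^sub>C\<close>, solving the variational inequality for \<open>(v, p)\<close>
  means solving \<open>x = T (v + A x + lam x - f (x, p))\<close>. Near the reference point \<open>T\<close> has Lipschitz
  constant \<open>1 / (lam + c)\<close>, while strict differentiability bounds that of the argument by
  \<open>lam + c / 2\<close>: this is a contraction, and its fixed points form the localized solution map. The
  remaining modulus \<open>c / 2\<close> serves as \<open>\<kappa>\<close>, because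
  \<open>\<kappa> \<parallel>z\<parallel>\<^sup>2 \<le> d \<bullet> z\<close> is the same as \<open>\<parallel>d - 2 \<kappa> z\<parallel> \<le> \<parallel>d\<parallel>\<close>. A change of parameter is absorbed
  into \<open>v\<close> at cost \<open>L\<close> times the distance, once on each side of this inequality, whence the
  factor 2 in \<open>l\<close>.\<close>
lemma lipschitz_fully_stable_if_weak_outer_critical_positive:
  fixes C :: "'a::{real_inner, banach} set"
    and f :: "'a \<times> 'p::metric_space \<Rightarrow> 'a" and A :: "'a \<Rightarrow>\<^sub>L 'a"
  assumes C: "closed C" "convex C"
    and sol: "vbar - f (xbar, pbar) \<in> normal_cone C xbar"
    and strict: "\<And>e. e > 0 \<Longrightarrow> \<exists>\<delta>>0. \<forall>x\<in>ball xbar \<delta>. \<forall>y\<in>ball xbar \<delta>. \<forall>p\<in>ball pbar \<delta>.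
        norm (f (x, p) - f (y, p) - blinfun_apply A (x - y)) \<le> e * norm (x - y)"
    and lipp: "\<exists>\<delta>>0. \<forall>x\<in>ball xbar \<delta>. \<forall>p1\<in>ball pbar \<delta>. \<forall>p2\<in>ball pbar \<delta>.
        norm (f (x, p1) - f (x, p2)) \<le> L * dist p1 p2" and L: "L > 0"
    and leg: "legendre_form (\<lambda>w. blinfun_apply A w \<bullet> w)"
    and pos: "\<And>w. w \<in> weak_outer_critical C xbar (vbar - f (xbar, pbar)) \<Longrightarrow> w \<noteq> 0 \<Longrightarrow> blinfun_apply A w \<bullet> w > 0"
  shows "lipschitz_fully_stable (pvi_solutions f C) vbar pbar xbar"
proof -
  define vhat where "vhat = vbar - f (xbar, pbar)"
  define lam where "lam = norm A + 1"
  have lam: "lam > 0" by (simp add: lam_def add_nonneg_pos)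
  obtain c e where c: "c > 0" and e: "e > 0" and
    cpos: "\<And>y n w. n \<in> normal_cone C y \<Longrightarrow> norm (y - xbar) < e \<Longrightarrow> norm (n - vhat) < e \<Longrightarrow>
       w \<in> critical_cone C y n \<Longrightarrow> c * norm w ^ 2 \<le> blinfun_apply A w \<bullet> w"
    using legendre_form_uniform_positivity[OF leg pos] unfolding vhat_def by metis
  obtain T where T: "\<And>u. u - blinfun_apply A (T u) - lam *\<^sub>R T u \<in> normal_cone C (T u)"
    using resolvent_exists[OF C, of A lam] normal_coneD(1)[OF sol] by (metis empty_iff lam_def less_add_one)
  have Tuniq: "T u = x" if "u - blinfun_apply A x - lam *\<^sub>R x \<in> normal_cone C x" for u x
    using resolvent_nonexpansive[of u A "T u" C u x] T that unfolding lam_def by simp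
  define u0 where "u0 = blinfun_apply A xbar + lam *\<^sub>R xbar + vhat"
  have T0: "T u0 = xbar" by (rule Tuniq) (use sol in \<open>simp add: u0_def vhat_def\<close>)
  obtain \<rho> where \<rho>: "\<rho> > 0" and Tmono: "\<And>u1 u2. u1 \<in> ball u0 \<rho> \<Longrightarrow> u2 \<in> ball u0 \<rho> \<Longrightarrow>
       (c + lam) * norm (T u1 - T u2) ^ 2 \<le> (u1 - u2) \<bullet> (T u1 - T u2)"
    using resolvent_locally_strongly_monotone[OF C(2) _ T[unfolded lam_def] sol _ e, of c thesis] leg c cpos
    unfolding u0_def vhat_def lam_def legendre_form_def by auto
  obtain \<delta>1 where \<delta>1: "\<delta>1 > 0" and st: "\<And>x y p. x \<in> ball xbar \<delta>1 \<Longrightarrow> y \<in> ball xbar \<delta>1 \<Longrightarrow> p \<in> ball pbar \<delta>1 \<Longrightarrow>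
      norm (f (x, p) - f (y, p) - blinfun_apply A (x - y)) \<le> c / 2 * norm (x - y)"
    using strict[of "c / 2"] c by auto
  obtain \<delta>2 where \<delta>2: "\<delta>2 > 0" and lp: "\<And>x p1 p2. x \<in> ball xbar \<delta>2 \<Longrightarrow> p1 \<in> ball pbar \<delta>2 \<Longrightarrow> p2 \<in> ball pbar \<delta>2 \<Longrightarrow>
      norm (f (x, p1) - f (x, p2)) \<le> L * dist p1 p2"
    using lipp by blast
  \<comment> \<open>The radius \<open>r\<close> keeps the arguments of \<open>T\<close> inside the ball of strong monotonicity. The
    tolerances for \<open>v\<close> and \<open>p\<close> use up half each of the margin \<open>c r / 2\<close> by which the
    contraction maps the ball of radius \<open>r\<close> into itself.\<close>
  define r where "r = min (min \<delta>1 \<delta>2 / 2) (\<rho> / (2 * (c + lam)))"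
  define \<eta> where "\<eta> = min (min \<delta>1 \<delta>2) (c * r / (4 * L))"
  have r: "r > 0" "r < \<delta>1" "r < \<delta>2" using \<delta>1 \<delta>2 \<rho> c lam by (auto simp: r_def)
  have r\<rho>: "(c + lam) * r < \<rho>"
  proof -
    have "r \<le> \<rho> / (2 * (c + lam))" by (simp add: r_def)
    then have "(c + lam) * r \<le> \<rho> / 2" using c lam by (simp add: field_simps)
    then show ?thesis using \<rho> by simp
  qed
  have \<eta>: "\<eta> > 0" "\<eta> \<le> \<delta>1" "\<eta> \<le> \<delta>2" "L * \<eta> \<le> c * r / 4"
  proof -
    have "\<eta> \<le> c * r / (4 * L)" by (simp add: \<eta>_def)
    then show "L * \<eta> \<le> c * r / 4" using L by (simp add: field_simps)
  qed (use \<delta>1 \<delta>2 c r L in \<open>auto simp: \<eta>_def\<close>)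
  define V where "V = ball vbar (c * r / 4)"
  define Q where "Q = ball pbar \<eta>"
  define U where "U = cball xbar r"
  have Ub: "x \<in> ball xbar \<delta>1" "x \<in> ball xbar \<delta>2" if "x \<in> U" for x
    using that r by (auto simp: U_def)
  have Qb: "p \<in> ball pbar \<delta>1" "p \<in> ball pbar \<delta>2" if "p \<in> Q" for p
    using that \<eta> by (auto simp: Q_def)
  have xU: "xbar \<in> U" and pQ: "pbar \<in> Q" using r \<eta> by (auto simp: U_def Q_def)
  define g where "g x p = blinfun_apply A x + lam *\<^sub>R x - f (x, p)" for x p
  have glip: "norm (g x p - g y p) \<le> (lam + c / 2) * norm (x - y)" if "x \<in> U" "y \<in> U" "p \<in> Q" for x y p
  proof -
    have "g x p - g y p = lam *\<^sub>R (x - y) - (f (x, p) - f (y, p) - blinfun_apply A (x - y))"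
      by (simp add: g_def blinfun.diff_right algebra_simps)
    also have "norm \<dots> \<le> norm (lam *\<^sub>R (x - y)) + norm (f (x, p) - f (y, p) - blinfun_apply A (x - y))"
      by (rule norm_triangle_ineq4)
    also have "\<dots> \<le> lam * norm (x - y) + c / 2 * norm (x - y)"
      using st[OF Ub(1)[OF that(1)] Ub(1)[OF that(2)] Qb(1)[OF that(3)]] lam by simp
    finally show ?thesis by (simp add: algebra_simps)
  qed
  have gp: "norm (f (x, p1) - f (x, p2)) \<le> L * dist p1 p2" if "x \<in> U" "p1 \<in> Q" "p2 \<in> Q" for x p1 p2
    using lp Ub(2) Qb(2) that by blast
  have u0g: "u0 = vbar + g xbar pbar" by (simp add: u0_def g_def vhat_def)
  have near: "norm (v + g x p - u0) \<le> (c + lam) * r" if "v \<in> V" "p \<in> Q" "x \<in> U" for v p x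
  proof -
    have "v + g x p - u0 = (v - vbar) + (g x p - g xbar p) - (f (xbar, p) - f (xbar, pbar))"
      by (simp add: u0g g_def)
    also have "norm \<dots> \<le> norm (v - vbar) + norm (g x p - g xbar p) + norm (f (xbar, p) - f (xbar, pbar))"
      by (meson add_mono norm_triangle_ineq norm_triangle_ineq4 order_refl order_trans)
    also have "\<dots> \<le> c * r / 4 + (lam + c / 2) * r + c * r / 4"
    proof (intro add_mono)
      show "norm (v - vbar) \<le> c * r / 4" using that(1) by (simp add: V_def dist_norm norm_minus_commute)
      have "norm (x - xbar) \<le> r" using that(3) by (simp add: U_def dist_norm norm_minus_commute)
      then show "norm (g x p - g xbar p) \<le> (lam + c / 2) * r"
        using order_trans[OF glip[OF that(3) xU that(2)] mult_left_mono] lam c by simp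
      have "dist p pbar \<le> \<eta>" using that(2) by (simp add: Q_def dist_commute)
      then show "norm (f (xbar, p) - f (xbar, pbar)) \<le> c * r / 4"
        using order_trans[OF gp[OF xU that(2) pQ] mult_left_mono[of _ \<eta> L]] L \<eta>(4) by simp
    qed
    finally show ?thesis by (simp add: algebra_simps)
  qed
  have nearb: "v + g x p \<in> ball u0 \<rho>" if "v \<in> V" "p \<in> Q" "x \<in> U" for v p x
    using near[OF that] r\<rho> by (simp add: dist_norm norm_minus_commute)
  have fix_iff: "T (v + g x p) = x \<longleftrightarrow> x \<in> pvi_solutions f C v p" for v p x
  proof
    assume "T (v + g x p) = x"
    then show "x \<in> pvi_solutions f C v p" using T[of "v + g x p"] by (simp add: pvi_solutions_iff g_def)
  next
    assume "x \<in> pvi_solutions f C v p"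
    then show "T (v + g x p) = x" by (intro Tuniq) (simp add: pvi_solutions_iff g_def)
  qed
  have ex1: "\<exists>!x\<in>U. T (v + g x p) = x" if v: "v \<in> V" and p: "p \<in> Q" for v p
  proof (rule Banach_fix[of _ "(lam + c / 2) / (lam + c)"])
    show "complete U" unfolding U_def by (simp add: complete_eq_closed)
    show "(\<lambda>x. T (v + g x p)) ` U \<subseteq> U"
    proof safe
      fix x assume x: "x \<in> U"
      have "(c + lam) * norm (T (v + g x p) - T u0) \<le> norm (v + g x p - u0)"
        by (intro norm_le_if_strongly_monotone Tmono nearb v p x) (simp add: \<rho>)
      then have "(c + lam) * norm (T (v + g x p) - xbar) \<le> (c + lam) * r"
        using near[OF v p x] unfolding T0 by linarith
      then show "T (v + g x p) \<in> U" using c lam by (simp add: U_def dist_norm norm_minus_commute)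
    qed
    fix x y assume xy: "x \<in> U" "y \<in> U"
    have "(c + lam) * norm (T (v + g x p) - T (v + g y p)) \<le> norm (v + g x p - (v + g y p))"
      by (intro norm_le_if_strongly_monotone Tmono nearb v p xy)
    also have "\<dots> \<le> (lam + c / 2) * norm (x - y)" using glip[OF xy p] by simp
    finally show "dist (T (v + g x p)) (T (v + g y p)) \<le> (lam + c / 2) / (lam + c) * dist x y"
      using c lam by (simp add: dist_norm field_simps)
  qed (use xU c lam in auto)
  define \<theta> where "\<theta> v p = (THE x. x \<in> U \<and> T (v + g x p) = x)" for v p
  have \<theta>: "\<theta> v p \<in> U" "T (v + g (\<theta> v p) p) = \<theta> v p" if "v \<in> V" "p \<in> Q" for v p
    using theI'[OF ex1[OF that]] unfolding \<theta>_def by auto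
  have \<theta>u: "x = \<theta> v p" if "v \<in> V" "p \<in> Q" "x \<in> U" "T (v + g x p) = x" for v p x
    using ex1[OF that(1,2)] \<theta>[OF that(1,2)] that(3,4) by blast
  have est: "norm ((v1 - v2) - c *\<^sub>R (\<theta> v1 p1 - \<theta> v2 p2)) \<le> norm (v1 - v2) + 2 * L * dist p1 p2"
    if v: "v1 \<in> V" "v2 \<in> V" and p: "p1 \<in> Q" "p2 \<in> Q" for v1 v2 p1 p2
  proof -
    define x1 where "x1 = \<theta> v1 p1"
    define x2 where "x2 = \<theta> v2 p2"
    define z where "z = x1 - x2"
    define b where "b = f (x2, p1) - f (x2, p2)"
    define d where "d = v1 - v2 - b"
    have x: "x1 \<in> U" "x2 \<in> U" "T (v1 + g x1 p1) = x1" "T (v2 + g x2 p2) = x2"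
      using \<theta> v p by (auto simp: x1_def x2_def)
    have bL: "norm b \<le> L * dist p1 p2" unfolding b_def by (rule gp[OF x(2) p])
    have "(c + lam) * norm z ^ 2 \<le> (v1 + g x1 p1 - (v2 + g x2 p2)) \<bullet> z"
      using Tmono[OF nearb[OF v(1) p(1) x(1)] nearb[OF v(2) p(2) x(2)]] by (simp add: x z_def)
    also have "v1 + g x1 p1 - (v2 + g x2 p2) = d + (g x1 p1 - g x2 p1)"
      by (simp add: d_def b_def g_def)
    also have "(d + (g x1 p1 - g x2 p1)) \<bullet> z \<le> d \<bullet> z + (lam + c / 2) * norm z ^ 2"
    proof -
      have "(g x1 p1 - g x2 p1) \<bullet> z \<le> norm (g x1 p1 - g x2 p1) * norm z" by (rule norm_cauchy_schwarz)
      also have "\<dots> \<le> ((lam + c / 2) * norm z) * norm z"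
        using glip[OF x(1,2) p(1)] by (intro mult_right_mono) (auto simp: z_def)
      finally show ?thesis by (simp add: inner_simps power2_eq_square)
    qed
    finally have dz: "c / 2 * norm z ^ 2 \<le> d \<bullet> z" by (simp add: algebra_simps)
    have "norm (d - c *\<^sub>R z) ^ 2 = norm d ^ 2 - 2 * c * (d \<bullet> z - c / 2 * norm z ^ 2)"
      unfolding power2_norm_eq_inner by (simp add: inner_simps inner_commute algebra_simps)
    also have "\<dots> \<le> norm d ^ 2" using dz c by simp
    finally have "norm (d - c *\<^sub>R z) \<le> norm d" by (rule power2_le_imp_le) simp
    moreover have "norm ((v1 - v2) - c *\<^sub>R z) \<le> norm (d - c *\<^sub>R z) + norm b"
      using norm_triangle_ineq[of "d - c *\<^sub>R z" b] by (simp add: d_def algebra_simps)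
    moreover have "norm d \<le> norm (v1 - v2) + norm b" unfolding d_def by (rule norm_triangle_ineq4)
    ultimately show ?thesis using bL unfolding z_def x1_def x2_def by simp
  qed
  show ?thesis
    unfolding lipschitz_fully_stable_def
  proof (rule conjI; (rule exI[of _ V], rule exI[of _ Q], rule exI[of _ U], rule exI[of _ "c / 2"],
        rule exI[of _ "2 * L"], rule exI[of _ \<theta>], intro conjI ballI)?)
    show "xbar \<in> pvi_solutions f C vbar pbar" using sol by (simp add: pvi_solutions_iff)
    show "vbar \<in> interior V" "pbar \<in> interior Q" using c r \<eta> by (auto simp: V_def Q_def interior_open)
    show "xbar \<in> interior U" using r ball_subset_cball[of xbar r] interior_maximal[of "ball xbar r" U]
      by (auto simp: U_def)
    show "{(v, p, x). v \<in> V \<and> p \<in> Q \<and> x = \<theta> v p} = {(v, p, x). x \<in> pvi_solutions f C v p} \<inter> V \<times> Q \<times> U"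
      using \<theta> \<theta>u by (auto simp flip: fix_iff)
  qed (use c L \<theta> est in auto)
qed

section \<open>Necessity for polyhedric sets\<close>

text \<open>Full stability at the fixed parameter says that \<open>f (\<cdot>, pbar) + N\<^sub>C\<close> is locally strongly
  monotone. If \<open>y\<close> is a radial direction orthogonal to the normal \<open>n\<close> at \<open>x\<close>, then \<open>n\<close> is still
  normal at \<open>x + t y\<close> for small \<open>t > 0\<close>, so \<open>n\<close> cancels from the monotonicity inequality, and
  dividing by \<open>t\<^sup>2\<close> bounds the derivative in direction \<open>y\<close> from below. Polyhedricity
  states that such directions are dense in the critical cone; norm convergence then carries the
  bound to the strong outer limit.\<close>
lemma strong_outer_critical_positive_if_fully_stable:
  fixes C :: "'a::real_inner set"
    and f :: "'a \<times> 'p::metric_space \<Rightarrow> 'a"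
    and f' :: "'a \<times> 'p \<Rightarrow> 'a \<Rightarrow>\<^sub>L 'a"
  assumes C: "convex C"
    and der: "\<forall>\<^sub>F (x, p) in nhds (xbar, pbar). ((\<lambda>y. f (y, p)) has_derivative blinfun_apply (f' (x, p))) (at x)"
    and cont: "isCont f' (xbar, pbar)"
    and poly: "polyhedric C"
    and stab: "lipschitz_fully_stable (pvi_solutions f C) vbar pbar xbar"
    and w: "w \<in> strong_outer_critical C xbar (vbar - f (xbar, pbar))" "w \<noteq> 0"
  shows "blinfun_apply (f' (xbar, pbar)) w \<bullet> w > 0"
proof -
  define F where "F x = f (x, pbar)" for x
  define F' where "F' x = f' (x, pbar)" for x
  obtain V Q U \<kappa> l \<theta> where V: "vbar \<in> interior V" and Q: "pbar \<in> interior Q" and U: "xbar \<in> interior U"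
    and \<kappa>: "(\<kappa>::real) > 0"
    and gph: "{(v, p, x). v \<in> V \<and> p \<in> Q \<and> x = \<theta> v p} = {(v, p, x). x \<in> pvi_solutions f C v p} \<inter> V \<times> Q \<times> U"
    and est: "\<forall>v1\<in>V. \<forall>v2\<in>V. \<forall>p1\<in>Q. \<forall>p2\<in>Q.
          norm ((v1 - v2) - (2 * \<kappa>) *\<^sub>R (\<theta> v1 p1 - \<theta> v2 p2)) \<le> norm (v1 - v2) + l * dist p1 p2"
    using stab unfolding lipschitz_fully_stable_def by blast
  have pQ: "pbar \<in> Q" using Q interior_subset by blast
  have tp: "filterlim (\<lambda>x. (x, pbar)) (nhds (xbar, pbar)) (nhds xbar)"
    by (intro tendsto_Pair tendsto_const filterlim_ident)
  have evd: "\<forall>\<^sub>F x in nhds xbar. (F has_derivative blinfun_apply (F' x)) (at x)"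
    using eventually_compose_filterlim[OF der tp] by (simp add: F_def[abs_def] F'_def)
  have F'cont: "isCont F' xbar"
    using isCont_o2[of xbar "\<lambda>x. (x, pbar)" f'] cont by (simp add: F'_def[abs_def])
  \<comment> \<open>Strong monotonicity of the graph of \<open>F + N\<close> near the reference point.\<close>
  have mono: "\<kappa> * norm (x1 - x2) ^ 2 \<le> (F x1 + n1 - (F x2 + n2)) \<bullet> (x1 - x2)"
    if "n1 \<in> normal_cone C x1" "n2 \<in> normal_cone C x2" "x1 \<in> U" "x2 \<in> U" "F x1 + n1 \<in> V" "F x2 + n2 \<in> V"
    for x1 x2 n1 n2
  proof -
    have th: "x = \<theta> (F x + n) pbar" if "n \<in> normal_cone C x" "x \<in> U" "F x + n \<in> V" for x n
    proof -
      have "(F x + n, pbar, x) \<in> {(v, p, x). x \<in> pvi_solutions f C v p} \<inter> V \<times> Q \<times> U"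
        using that pQ by (simp add: pvi_solutions_iff F_def)
      then show ?thesis unfolding gph[symmetric] by simp
    qed
    define v where "v = F x1 + n1 - (F x2 + n2)"
    define z where "z = x1 - x2"
    have "norm (v - (2 * \<kappa>) *\<^sub>R z) \<le> norm v"
      using est[rule_format, OF that(5,6) pQ pQ] th[OF that(1,3,5)] th[OF that(2,4,6)]
      by (simp add: v_def z_def)
    then have "norm (v - (2 * \<kappa>) *\<^sub>R z) ^ 2 \<le> norm v ^ 2" by (intro power_mono) auto
    moreover have "norm (v - (2 * \<kappa>) *\<^sub>R z) ^ 2 = norm v ^ 2 + 4 * \<kappa> * (\<kappa> * norm z ^ 2 - v \<bullet> z)"
      unfolding power2_norm_eq_inner by (simp add: inner_simps inner_commute algebra_simps)
    ultimately have "4 * \<kappa> * (\<kappa> * norm z ^ 2 - v \<bullet> z) \<le> 0" by simp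
    then show ?thesis using \<kappa> by (simp add: mult_le_0_iff v_def z_def)
  qed
  have crit: "\<kappa> * norm y ^ 2 \<le> blinfun_apply (F' x) y \<bullet> y"
    if n: "n \<in> normal_cone C x" and xU: "x \<in> interior U" and nV: "F x + n \<in> interior V"
      and d: "(F has_derivative blinfun_apply (F' x)) (at x)" and y: "y \<in> critical_cone C x n" for x n y
  proof -
    have rad: "\<kappa> * norm y ^ 2 \<le> blinfun_apply (F' x) y \<bullet> y" if y: "y \<in> radial_cone C x" "n \<bullet> y = 0" for y
    proof -
      obtain t0 where t0: "t0 > 0" "x + t0 *\<^sub>R y \<in> C" using y(1) by (auto simp: radial_cone_iff)
      have line: "((\<lambda>t. x + t *\<^sub>R y) \<longlongrightarrow> x) (at_right 0)" by (auto intro!: tendsto_eq_intros)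
      have Fx: "isCont F x" using d has_derivative_continuous by blast
      have "((\<lambda>t. F (x + t *\<^sub>R y) + n) \<longlongrightarrow> F x + n) (at_right 0)"
        by (intro tendsto_intros isCont_tendsto_compose[OF Fx] line)
      then have ev: "\<forall>\<^sub>F t in at_right 0. F (x + t *\<^sub>R y) + n \<in> interior V"
        by (rule topological_tendstoD[OF _ open_interior nV])
      have ev2: "\<forall>\<^sub>F t in at_right 0. x + t *\<^sub>R y \<in> interior U"
        by (rule topological_tendstoD[OF line]) (use xU in auto)
      have ev3: "\<forall>\<^sub>F t in at_right (0::real). t \<in> {0<..<t0}" by (rule eventually_at_right_real[OF t0(1)])
      have lim: "((\<lambda>t. ((F (x + t *\<^sub>R y) - F x) \<bullet> y) / t) \<longlongrightarrow> blinfun_apply (F' x) y \<bullet> y) (at_right 0)"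
      proof -
        have "((\<lambda>t::real. x + t *\<^sub>R y) has_derivative (\<lambda>t. t *\<^sub>R y)) (at 0)"
          by (auto intro!: derivative_eq_intros)
        then have "((\<lambda>t::real. F (x + t *\<^sub>R y)) has_derivative (\<lambda>t. blinfun_apply (F' x) (t *\<^sub>R y))) (at 0)"
          by (rule has_derivative_compose) (use d in simp)
        then have "((\<lambda>t::real. F (x + t *\<^sub>R y) \<bullet> y) has_derivative (\<lambda>t. blinfun_apply (F' x) (t *\<^sub>R y) \<bullet> y)) (at 0)"
          by (rule has_derivative_inner_left)
        then have "((\<lambda>t. F (x + t *\<^sub>R y) \<bullet> y) has_field_derivative blinfun_apply (F' x) y \<bullet> y) (at 0)"
          by (rule has_derivative_imp_has_field_derivative) (simp add: blinfun.scaleR_right)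
        then have "((\<lambda>t. ((F (x + t *\<^sub>R y) - F x) \<bullet> y) / t) \<longlongrightarrow> blinfun_apply (F' x) y \<bullet> y) (at 0)"
          by (simp add: DERIV_def inner_diff_left)
        then show ?thesis by (rule filterlim_mono) (auto simp: at_le)
      qed
      have "\<forall>\<^sub>F t in at_right 0. \<kappa> * norm y ^ 2 \<le> ((F (x + t *\<^sub>R y) - F x) \<bullet> y) / t"
        using ev ev2 ev3
      proof eventually_elim
        case (elim t)
        have xt: "x + t *\<^sub>R y \<in> C"
          by (rule radial_step_shrink[OF C normal_coneD(1)[OF n] t0(2)]) (use elim in auto)
        have nt: "n \<in> normal_cone C (x + t *\<^sub>R y)"
        proof -
          have "n \<bullet> (u - (x + t *\<^sub>R y)) = n \<bullet> (u - x)" for u using y(2) by (simp add: inner_simps)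
          then show ?thesis using normal_coneD(2)[OF n] xt by (simp add: normal_cone_def)
        qed
        have "\<kappa> * norm (t *\<^sub>R y) ^ 2 \<le> t * ((F (x + t *\<^sub>R y) - F x) \<bullet> y)"
          using mono[OF nt n] elim xU nV interior_subset by (fastforce simp: algebra_simps)
        then have "t * (t * (\<kappa> * norm y ^ 2)) \<le> t * ((F (x + t *\<^sub>R y) - F x) \<bullet> y)"
          by (simp add: power_mult_distrib power2_eq_square algebra_simps)
        then have "t * (\<kappa> * norm y ^ 2) \<le> (F (x + t *\<^sub>R y) - F x) \<bullet> y" using elim by simp
        then show ?case using elim by (simp add: field_simps)
      qed
      then show ?thesis by (intro tendsto_lowerbound[OF lim]) auto
    qed
    have "critical_cone C x n = closure (radial_cone C x \<inter> {n}\<^sup>\<bottom>)"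
      using poly n normal_coneD(1)[OF n] by (simp add: polyhedric_def)
    then obtain ys where ys: "\<And>k. ys k \<in> radial_cone C x \<inter> {n}\<^sup>\<bottom>" "ys \<longlonglongrightarrow> y"
      using y closure_sequential by metis
    have "\<kappa> * norm (ys k) ^ 2 \<le> blinfun_apply (F' x) (ys k) \<bullet> ys k" for k
      using rad[of "ys k"] ys(1)[of k] by (auto simp: orthogonal_comp_def orthogonal_def)
    then show ?thesis
      by (intro LIMSEQ_le[of "\<lambda>k. \<kappa> * norm (ys k) ^ 2" _ "\<lambda>k. blinfun_apply (F' x) (ys k) \<bullet> ys k"])
         (auto intro!: tendsto_intros ys(2))
  qed
  obtain xs vs zs where s: "\<And>k. vs k \<in> normal_cone C (xs k)" "xs \<longlonglongrightarrow> xbar"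
      "vs \<longlonglongrightarrow> vbar - F xbar" "\<And>k. zs k \<in> critical_cone C (xs k) (vs k)" "zs \<longlonglongrightarrow> w"
    using w(1) unfolding strong_outer_critical_def F_def by blast
  have "isCont F xbar" using eventually_nhds_x_imp_x[OF evd] has_derivative_continuous by blast
  then have "(\<lambda>k. F (xs k) + vs k) \<longlonglongrightarrow> F xbar + (vbar - F xbar)"
    by (intro tendsto_intros s(2,3) isCont_tendsto_compose[of xbar F])
  then have "\<forall>\<^sub>F k in sequentially. F (xs k) + vs k \<in> interior V"
    by (rule topological_tendstoD) (use V in auto)
  moreover have "\<forall>\<^sub>F k in sequentially. xs k \<in> interior U"
    by (rule topological_tendstoD[OF s(2)]) (use U in auto)
  moreover have "\<forall>\<^sub>F k in sequentially. (F has_derivative blinfun_apply (F' (xs k))) (at (xs k))"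
    by (rule eventually_compose_filterlim[OF evd s(2)])
  ultimately have ev: "\<forall>\<^sub>F k in sequentially. \<kappa> * norm (zs k) ^ 2 \<le> blinfun_apply (F' (xs k)) (zs k) \<bullet> zs k"
    by eventually_elim (rule crit[OF s(1) _ _ _ s(4)])
  have "(\<lambda>k. F' (xs k)) \<longlonglongrightarrow> F' xbar" by (rule isCont_tendsto_compose[OF F'cont s(2)])
  then have "(\<lambda>k. blinfun_apply (F' (xs k)) (zs k) \<bullet> zs k) \<longlonglongrightarrow> blinfun_apply (F' xbar) w \<bullet> w"
    by (intro tendsto_intros s(5))
  moreover have "(\<lambda>k. \<kappa> * norm (zs k) ^ 2) \<longlonglongrightarrow> \<kappa> * norm w ^ 2" by (intro tendsto_intros s(5))
  ultimately have "\<kappa> * norm w ^ 2 \<le> blinfun_apply (F' xbar) w \<bullet> w"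
    using ev by (intro tendsto_le[OF sequentially_bot])
  moreover have "\<kappa> * norm w ^ 2 > 0" using \<kappa> w(2) by simp
  ultimately show ?thesis by (simp add: F'_def)
qed

section \<open>Second-order conditions for Lipschitzian full stability\<close>

theorem theorem5p4:
  fixes C :: "'a::{real_inner, banach} set"
    and f :: "'a \<times> 'p::metric_space \<Rightarrow> 'a"
    and f' :: "'a \<times> 'p \<Rightarrow> 'a \<Rightarrow>\<^sub>L 'a"
    and xbar vbar vhat :: 'a and pbar :: 'p
  assumes "closed C" and "convex C"
    and "xbar \<in> pvi_solutions f C vbar pbar"
    and "vhat = vbar - f (xbar, pbar)"
    and "\<forall>\<^sub>F (x, p) in nhds (xbar, pbar).
           ((\<lambda>y. f (y, p)) has_derivative blinfun_apply (f' (x, p))) (at x)"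
    and "isCont f' (xbar, pbar)"
    and "\<exists>U0 P0. \<exists>L>0. xbar \<in> interior U0 \<and> pbar \<in> interior P0 \<and>
           (\<forall>x\<in>U0. \<forall>p1\<in>P0. \<forall>p2\<in>P0. norm (f (x, p1) - f (x, p2)) \<le> L * dist p1 p2)"
  shows "(legendre_form (\<lambda>w. blinfun_apply (f' (xbar, pbar)) w \<bullet> w) \<longrightarrow>
           (\<forall>w\<in>weak_outer_critical C xbar vhat. w \<noteq> 0 \<longrightarrow>
              blinfun_apply (f' (xbar, pbar)) w \<bullet> w > 0) \<longrightarrow>
           lipschitz_fully_stable (pvi_solutions f C) vbar pbar xbar) \<and>
         (polyhedric C \<longrightarrow>
           lipschitz_fully_stable (pvi_solutions f C) vbar pbar xbar \<longrightarrow>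
           (\<forall>w\<in>strong_outer_critical C xbar vhat. w \<noteq> 0 \<longrightarrow>
              blinfun_apply (f' (xbar, pbar)) w \<bullet> w > 0))"
proof (intro conjI impI ballI)
  assume leg: "legendre_form (\<lambda>w. blinfun_apply (f' (xbar, pbar)) w \<bullet> w)"
    and pos: "\<forall>w\<in>weak_outer_critical C xbar vhat. w \<noteq> 0 \<longrightarrow> blinfun_apply (f' (xbar, pbar)) w \<bullet> w > 0"
  obtain U0 P0 L where L: "L > 0" and UP: "xbar \<in> interior U0" "pbar \<in> interior P0"
    and lip: "\<And>x p1 p2. x \<in> U0 \<Longrightarrow> p1 \<in> P0 \<Longrightarrow> p2 \<in> P0 \<Longrightarrow> norm (f (x, p1) - f (x, p2)) \<le> L * dist p1 p2"
    using assms(7) by blast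
  obtain d1 d2 where d: "d1 > 0" "ball xbar d1 \<subseteq> U0" "d2 > 0" "ball pbar d2 \<subseteq> P0"
    using UP by (auto simp: mem_interior)
  show "lipschitz_fully_stable (pvi_solutions f C) vbar pbar xbar"
  proof (rule lipschitz_fully_stable_if_weak_outer_critical_positive[OF assms(1,2) _ _ _ L leg])
    show "vbar - f (xbar, pbar) \<in> normal_cone C xbar" using assms(3) by (simp add: pvi_solutions_iff)
    show "\<exists>\<delta>>0. \<forall>x\<in>ball xbar \<delta>. \<forall>y\<in>ball xbar \<delta>. \<forall>p\<in>ball pbar \<delta>.
        norm (f (x, p) - f (y, p) - blinfun_apply (f' (xbar, pbar)) (x - y)) \<le> e * norm (x - y)"
      if "e > 0" for e
      using uniform_strict_differentiability[OF assms(5,6) that] by metis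
    show "\<exists>\<delta>>0. \<forall>x\<in>ball xbar \<delta>. \<forall>p1\<in>ball pbar \<delta>. \<forall>p2\<in>ball pbar \<delta>.
        norm (f (x, p1) - f (x, p2)) \<le> L * dist p1 p2"
      using d by (intro exI[of _ "min d1 d2"]) (auto intro!: lip)
  qed (use pos assms(4) in auto)
next
  fix w assume "polyhedric C" "lipschitz_fully_stable (pvi_solutions f C) vbar pbar xbar"
    "w \<in> strong_outer_critical C xbar vhat" "w \<noteq> 0"
  then show "blinfun_apply (f' (xbar, pbar)) w \<bullet> w > 0"
    using strong_outer_critical_positive_if_fully_stable[OF assms(2,5,6)] assms(4) by blast
qed

end
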